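(* Let $\{F_\theta:\theta\in\Theta\}$, $\Theta\subset\mathbb{R}$, be a family of distribution functions with support on $Z_0=\{0,1,2,\dots\}$ and probability densities (mass functions) $p(x,\theta)$, and let $\psi_0(x,\theta)=\partial\log p(x,\theta)/\partial\theta$ be its score function. Let $x_1,\dots,x_n$ be a random sample of $F_\theta$ with empirical distribution function $F_n$. Assume that $\psi_0(x,\theta)$ is continuous and strictly monotone in $x$ and $\theta$. Then the estimator with smallest gross-error sensitivity (GES) is $\widehat\theta_n$ defined by $$\mathrm{umed}(F_n)=\mathrm{umed}(F_{\widehat\theta_n}).$$
   Context: For a distribution $F$ with support on $Z_0=\{0,1,2,\dots\}$ and probability mass function $p$ (with $F(-1)=0$), let $k_0(F)=\min\{k:F(k)\ge 0.5\}$. The uniform median of $F$ is the median of $x+u$, where $x\sim F$ and $u$ uniform on $[-0.5,0.5]$ are independent; explicitly $$\mathrm{umed}(F)=k_0(F)-0.5+\frac{0.5-F(k_0(F)-1)}{p(k_0(F))}.$$ The empirical distribution $F_n$ has mass function $p_n(k)=\#\{i:x_i=k\}/n$. The estimators under comparison are Fisher-consistent M-estimators, i.e. solutions of equations of the form $\sum_{i=1}^n\psi(x_i,\theta)=0$, with no restriction on the asymptotic variance. The gross-error sensitivity (GES) of an estimator is the maximum of the absolute values of its influence function (the influence function at $x$ being, as usual, the derivative at $\varepsilon=0$ of the asymptotic value of the estimator under $(1-\varepsilon)F_\theta+\varepsilon\delta_x$).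
   Formalization: Θ is an open interval with common support; competitors need nonzero ψ continuous in θ, with expectation locally finite and differentiable, and an influence function; uniqueness excludes distributions split in half by an unobserved value. *)

theory Defs
  imports "HOL-Probability.Probability"
begin

section \<open>Distributions on the nonnegative integers\<close>

text \<open>The value of the distribution function of \<open>G\<close> just below \<open>k\<close> is
  \<open>prob G {..<k}\<close>; for \<open>k = 0\<close> it is \<open>0\<close>.\<close>

definition k0 :: "nat pmf \<Rightarrow> nat" where
  "k0 G = (LEAST k. measure_pmf.prob G {..k} \<ge> 1/2)"

definition umed :: "nat pmf \<Rightarrow> real" where
  "umed G = real (k0 G) - 1/2 + (1/2 - measure_pmf.prob G {..<k0 G}) / pmf G (k0 G)"

definition empirical :: "nat list \<Rightarrow> nat pmf" where
  "empirical xs = pmf_of_multiset (mset xs)"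

text \<open>The mixture \<open>(1 - \<epsilon>) G + \<epsilon> \<delta>\<^sub>x\<close>, meaningful for \<open>0 \<le> \<epsilon> \<le> 1\<close>.\<close>

definition contaminate :: "real \<Rightarrow> nat \<Rightarrow> nat pmf \<Rightarrow> nat pmf" where
  "contaminate \<epsilon> x G = bind_pmf (bernoulli_pmf \<epsilon>) (\<lambda>b. if b then return_pmf x else G)"

lemma pmf_empirical:
  assumes "xs \<noteq> []"
  shows "pmf (empirical xs) k = count_list xs k / length xs"
  using assms by (simp add: empirical_def count_mset count_list_eq_length_filter)

lemma pmf_contaminate:
  assumes "0 \<le> \<epsilon>" "\<epsilon> \<le> 1"
  shows "pmf (contaminate \<epsilon> x G) k = (1 - \<epsilon>) * pmf G k + \<epsilon> * indicator {x} k"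
  using assms by (auto simp: contaminate_def pmf_bind indicator_def)

definition score :: "(real \<Rightarrow> nat pmf) \<Rightarrow> nat \<Rightarrow> real \<Rightarrow> real" where
  "score F x \<theta> = deriv (\<lambda>t. ln (pmf (F t) x)) \<theta>"

section \<open>Estimators as statistical functionals\<close>

text \<open>
  An estimator is a functional \<open>T\<close> on a domain \<open>D\<close> of distributions (an estimating equation
  need not be solvable for every distribution). Its value at a sample is \<open>T (empirical xs)\<close>,
  its asymptotic value under \<open>G\<close> is \<open>T G\<close>.
\<close>

definition M_equation :: "(nat \<Rightarrow> real \<Rightarrow> real) \<Rightarrow> nat pmf \<Rightarrow> real \<Rightarrow> bool" where
  "M_equation \<psi> G t \<longleftrightarrow>
     integrable (measure_pmf G) (\<lambda>x. \<psi> x t) \<and> measure_pmf.expectation G (\<lambda>x. \<psi> x t) = 0"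

lemma M_equation_empirical:
  assumes "xs \<noteq> []"
  shows "M_equation \<psi> (empirical xs) t \<longleftrightarrow> (\<Sum>x\<leftarrow>xs. \<psi> x t) = 0"
proof -
  have set: "set_pmf (empirical xs) = set xs"
    using assms by (simp add: empirical_def)
  have "measure_pmf.expectation (empirical xs) (\<lambda>x. \<psi> x t)
      = (\<Sum>x\<in>set xs. pmf (empirical xs) x * \<psi> x t)"
    by (subst integral_measure_pmf_real[of "set xs"]) (auto simp: set mult.commute)
  also have "\<dots> = (\<Sum>x\<in>set xs. of_nat (count_list xs x) * \<psi> x t) / length xs"
    using assms by (simp add: pmf_empirical sum_divide_distrib)
  also have "(\<Sum>x\<in>A. of_nat (count_list ys x) * \<psi> x t) = (\<Sum>x\<leftarrow>ys. \<psi> x t)"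
    if "finite A" "set ys \<subseteq> A" for A ys
    using that(2)
  proof (induction ys)
    case (Cons y ys)
    have "(\<Sum>x\<in>A. of_nat (count_list (y # ys) x) * \<psi> x t)
        = (\<Sum>x\<in>A. of_nat (count_list ys x) * \<psi> x t + (if x = y then \<psi> x t else 0))"
      by (intro sum.cong) (auto simp: algebra_simps)
    with Cons that(1) show ?case
      by (simp add: sum.distrib)
  qed simp
  note this[of "set xs" xs, simplified]
  finally show ?thesis
    using assms by (auto simp: M_equation_def set intro!: integrable_measure_pmf_finite)
qed

definition M_estimator ::
    "real set \<Rightarrow> (nat \<Rightarrow> real \<Rightarrow> real) \<Rightarrow> nat pmf set \<Rightarrow> (nat pmf \<Rightarrow> real) \<Rightarrow> bool" where
  "M_estimator \<Theta> \<psi> D T \<longleftrightarrow> (\<forall>G\<in>D. T G \<in> \<Theta> \<and> M_equation \<psi> G (T G))"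

definition Fisher_consistent ::
    "(real \<Rightarrow> nat pmf) \<Rightarrow> real set \<Rightarrow> nat pmf set \<Rightarrow> (nat pmf \<Rightarrow> real) \<Rightarrow> bool" where
  "Fisher_consistent F \<Theta> D T \<longleftrightarrow> (\<forall>\<theta>\<in>\<Theta>. F \<theta> \<in> D \<and> T (F \<theta>) = \<theta>)"

text \<open>
  The distributions \<open>contaminate \<epsilon> x G\<close> exist for \<open>\<epsilon> \<ge> 0\<close> only, so the derivative at
  \<open>\<epsilon> = 0\<close> is the one-sided one.
\<close>

definition influence :: "(nat pmf \<Rightarrow> real) \<Rightarrow> nat pmf \<Rightarrow> nat \<Rightarrow> real" where
  "influence T G x = vector_derivative (\<lambda>\<epsilon>. T (contaminate \<epsilon> x G)) (at 0 within {0..1})"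

definition has_influence :: "nat pmf set \<Rightarrow> (nat pmf \<Rightarrow> real) \<Rightarrow> nat pmf \<Rightarrow> nat \<Rightarrow> bool" where
  "has_influence D T G x \<longleftrightarrow>
     (\<forall>\<^sub>F \<epsilon> in at_right 0. contaminate \<epsilon> x G \<in> D) \<and>
     (\<lambda>\<epsilon>. T (contaminate \<epsilon> x G)) differentiable (at 0 within {0..1})"

text \<open>\<open>S\<close> is the sample space; the value \<open>\<infinity>\<close> is allowed.\<close>

definition GES :: "nat set \<Rightarrow> (nat pmf \<Rightarrow> real) \<Rightarrow> nat pmf \<Rightarrow> ereal" where
  "GES S T G = (SUP x\<in>S. ereal \<bar>influence T G x\<bar>)"

text \<open>
  Regularity under which the influence function of an M-estimator is governed by its \<open>\<psi>\<close>:
  continuity and nondegeneracy of \<open>\<psi>\<close>, and differentiability of the expectation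
  \<open>(\<theta>', t) \<mapsto> E\<^bsub>\<theta>'\<^esub> \<psi>(x, t)\<close> on the diagonal. There is no condition on second moments of
  \<open>\<psi>\<close>. Without nondegeneracy, \<open>\<psi> = 0\<close> would make every functional an M-estimator.
  Without the differentiability, far tails of \<open>\<psi>(\<cdot>, t)\<close> that grow as \<open>t \<rightarrow> \<theta>\<close> could change
  the influence function at a single \<open>\<theta>\<close> arbitrarily.
\<close>

definition regular_psi ::
    "(real \<Rightarrow> nat pmf) \<Rightarrow> real set \<Rightarrow> nat set \<Rightarrow> (nat \<Rightarrow> real \<Rightarrow> real) \<Rightarrow> bool" where
  "regular_psi F \<Theta> S \<psi> \<longleftrightarrow> (\<forall>\<theta>\<in>\<Theta>.
     (\<forall>x\<in>S. isCont (\<psi> x) \<theta>) \<and>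
     (\<exists>x\<in>S. \<psi> x \<theta> \<noteq> 0) \<and>
     (\<forall>\<^sub>F (\<theta>', t) in nhds (\<theta>, \<theta>). integrable (measure_pmf (F \<theta>')) (\<lambda>x. \<psi> x t)) \<and>
     (\<lambda>(\<theta>', t). measure_pmf.expectation (F \<theta>') (\<lambda>x. \<psi> x t)) differentiable (at (\<theta>, \<theta>)))"

definition Fisher_consistent_M_estimator ::
    "(real \<Rightarrow> nat pmf) \<Rightarrow> real set \<Rightarrow> nat set \<Rightarrow> (nat \<Rightarrow> real \<Rightarrow> real) \<Rightarrow>
     nat pmf set \<Rightarrow> (nat pmf \<Rightarrow> real) \<Rightarrow> bool" where
  "Fisher_consistent_M_estimator F \<Theta> S \<psi> D T \<longleftrightarrow>
     M_estimator \<Theta> \<psi> D T \<and> Fisher_consistent F \<Theta> D T \<and> regular_psi F \<Theta> S \<psi> \<and>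
     (\<forall>\<theta>\<in>\<Theta>. \<forall>x\<in>S. has_influence D T (F \<theta>) x)"

section \<open>The estimator based on the uniform median\<close>

definition umed_dom :: "(real \<Rightarrow> nat pmf) \<Rightarrow> real set \<Rightarrow> nat pmf set" where
  "umed_dom F \<Theta> = {G. \<exists>t\<in>\<Theta>. umed G = umed (F t)}"

definition umed_est :: "(real \<Rightarrow> nat pmf) \<Rightarrow> real set \<Rightarrow> nat pmf \<Rightarrow> real" where
  "umed_est F \<Theta> G = (THE t. t \<in> \<Theta> \<and> umed G = umed (F t))"

end

theory Submission
  imports Defs
begin

text \<open>
  Write \<open>m t = umed (F t)\<close>. The estimating function of the uniform median estimator is Huber's
  \<open>\<psi>\<^sub>0(x, t) = max (-1/2) (min (1/2) (x - m t))\<close>, since \<open>E\<^bsub>G\<^esub> max (-1/2) (min (1/2) (x - m))\<close> is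
  \<open>1/2\<close> minus the distribution function of \<open>x + u\<close> at \<open>m\<close>. On the integers, \<open>\<psi>\<^sub>0(\<cdot>, \<theta>)\<close> equals
  \<open>-1/2\<close> to the left of \<open>k = k\<^sub>0(F\<^sub>\<theta>)\<close> and \<open>1/2\<close> to the right of it.

  For an M-estimator let \<open>\<Lambda>(\<theta>', t) = E\<^bsub>\<theta>'\<^esub> \<psi>(x, t)\<close>. Differentiating the estimating equation at the
  contaminated distribution gives \<open>\<partial>\<^sub>2\<Lambda> \<cdot> IF(x) = - \<psi>(x, \<theta>)\<close>, and Fisher consistency, \<open>\<Lambda>(t, t) = 0\<close>,
  gives \<open>\<partial>\<^sub>2\<Lambda> = - \<partial>\<^sub>1\<Lambda>\<close>. So one has to maximise \<open>\<partial>\<^sub>1\<Lambda>\<close> among \<open>\<psi>\<close> with \<open>\<bar>\<psi>\<bar> \<le> M\<close> and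
  \<open>E\<^bsub>\<theta>\<^esub> \<psi> = 0\<close>. Monotonicity of the score in \<open>x\<close> makes the likelihood ratio monotone, so
  \<open>p(x, \<theta>') - (p(k, \<theta>') / p(k, \<theta>)) p(x, \<theta>)\<close> has the sign of \<open>x - k\<close> (up to orientation), and
  so has \<open>2 M \<psi>\<^sub>0 - \<psi>\<close>. Hence \<open>E\<^bsub>\<theta>'\<^esub> (2 M \<psi>\<^sub>0 - \<psi>)\<close> is a series of nonnegative terms, and it dominates each
  of them; this yields the bound and, in the case of equality, \<open>\<psi> = 2 M \<psi>\<^sub>0\<close>. Working with
  the difference instead of its derivative avoids differentiating infinite sums.
\<close>

section \<open>Distributions on the natural numbers\<close>

lemma sums_expectation_pmf:
  fixes p :: "nat pmf" and f :: "nat \<Rightarrow> real"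
  assumes "integrable (measure_pmf p) f"
  shows "(\<lambda>n. pmf p n * f n) sums measure_pmf.expectation p f"
proof -
  have "integrable (density (count_space UNIV) (\<lambda>n. ennreal (pmf p n))) f"
    using assms by (simp add: measure_pmf_eq_density)
  then have "integrable (count_space UNIV) (\<lambda>n. pmf p n * f n)"
    by (simp add: integrable_density)
  then have "(\<lambda>n. pmf p n * f n) sums (\<integral>n. pmf p n * f n \<partial>count_space UNIV)"
    by (rule sums_integral_count_space_nat)
  moreover have "measure_pmf.expectation p f = (\<integral>n. pmf p n * f n \<partial>count_space UNIV)"
    by (simp add: measure_pmf_eq_density integral_density)
  ultimately show ?thesis by simp
qed

text \<open>As \<open>d\<close> has mean zero under \<open>P\<close>, subtracting
  \<open>pmf Q k\<close> times that mean turns \<open>pmf P k\<close> times the mean under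
  \<open>Q\<close> into a series with these terms. All are nonnegative, so the sum bounds each
  one.\<close>

lemma expectation_terms_le:
  fixes P Q :: "nat pmf" and d :: "nat \<Rightarrow> real"
  assumes "integrable (measure_pmf P) d" "integrable (measure_pmf Q) d"
    and "measure_pmf.expectation P d = 0"
    and nonneg: "\<And>x. x \<in> set_pmf P \<union> set_pmf Q \<Longrightarrow> 0 \<le> (pmf Q x * pmf P k - pmf Q k * pmf P x) * d x"
  shows "(pmf Q x * pmf P k - pmf Q k * pmf P x) * d x \<le> pmf P k * measure_pmf.expectation Q d"
proof -
  have "(\<lambda>n. pmf P k * (pmf Q n * d n) - pmf Q k * (pmf P n * d n)) sums
      (pmf P k * measure_pmf.expectation Q d - pmf Q k * measure_pmf.expectation P d)"
    using assms(1,2) by (intro sums_diff sums_mult sums_expectation_pmf)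
  then have s: "(\<lambda>n. (pmf Q n * pmf P k - pmf Q k * pmf P n) * d n) sums
      (pmf P k * measure_pmf.expectation Q d)"
    using assms(3) by (simp add: algebra_simps)
  have nn: "0 \<le> (pmf Q n * pmf P k - pmf Q k * pmf P n) * d n" for n
    using nonneg[of n] by (cases "n \<in> set_pmf P \<union> set_pmf Q") (auto simp: set_pmf_iff)
  have "sum (\<lambda>n. (pmf Q n * pmf P k - pmf Q k * pmf P n) * d n) {x} \<le>
      (\<Sum>n. (pmf Q n * pmf P k - pmf Q k * pmf P n) * d n)"
    using nn s by (intro sum_le_suminf) (auto simp: sums_iff)
  then show ?thesis using s by (simp add: sums_iff)
qed

section \<open>The uniform median as the point where the smoothed distribution function reaches
  1/2\<close>

lemma prob_atMost_tendsto_1: "(\<lambda>n. measure_pmf.prob G {..n::nat}) \<longlonglongrightarrow> 1"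
proof -
  have "(\<lambda>n. measure_pmf.prob G {..n}) \<longlonglongrightarrow> measure_pmf.prob G (\<Union>n. {..n})"
    by (rule measure_pmf.finite_Lim_measure_incseq) (auto simp: incseq_def)
  moreover have "(\<Union>n::nat. {..n}) = UNIV" by auto
  ultimately show ?thesis by simp
qed

lemma prob_atMost_gt_half: "\<exists>n::nat. measure_pmf.prob G {..n} > 1/2"
proof -
  have "\<forall>\<^sub>F n in sequentially. measure_pmf.prob G {..n} > 1/2"
    by (rule order_tendstoD(1)[OF prob_atMost_tendsto_1]) simp
  then show ?thesis by (auto simp: eventually_sequentially)
qed

lemma prob_atMost_eq: "measure_pmf.prob G {..n::nat} = measure_pmf.prob G {..<n} + pmf G n"
proof -
  have "{..n} = insert n {..<n}" by auto
  then show ?thesis by (simp add: measure_measure_pmf_finite)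
qed

text \<open>Replaces \<open>LEAST\<close> by an equation: 1/2 is reached at the fraction
  \<open>r\<close> of the unit cell around \<open>k\<close>. Here \<open>0 < r\<close> keeps the
  mass below \<open>k\<close> under 1/2 and \<open>r \<le> 1\<close> lifts the mass up to
  \<open>k\<close> to at least 1/2, so \<open>k\<close> is \<open>k0 G\<close>.\<close>

lemma umed_eqI:
  assumes eq: "measure_pmf.prob G {..<k} + r * pmf G k = 1/2" and "0 < r" "r \<le> 1" "pmf G k \<noteq> 0"
  shows "umed G = real k - 1/2 + r"
proof -
  have p: "pmf G k > 0" using assms(4) by (simp add: order_less_le)
  have less: "measure_pmf.prob G {..<k} < 1/2" using eq p \<open>0 < r\<close> by (smt (verit) mult_pos_pos)
  have "r * pmf G k \<le> 1 * pmf G k" using \<open>r \<le> 1\<close> p by (intro mult_right_mono) auto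
  then have ge: "measure_pmf.prob G {..k} \<ge> 1/2" using eq by (simp add: prob_atMost_eq)
  have "k0 G = k" unfolding k0_def
  proof (rule Least_equality)
    fix y assume y: "1/2 \<le> measure_pmf.prob G {..y}"
    show "k \<le> y"
    proof (rule ccontr)
      assume "\<not> k \<le> y"
      then have "measure_pmf.prob G {..y} \<le> measure_pmf.prob G {..<k}"
        by (intro measure_pmf.finite_measure_mono) auto
      with y less show False by simp
    qed
  qed (rule ge)
  moreover have "(1/2 - measure_pmf.prob G {..<k}) / pmf G k = r"
    using eq p by (simp add: field_simps)
  ultimately show ?thesis by (simp add: umed_def)
qed

lemma umed_cases:
  obtains k r where "0 < r" "r \<le> 1" "pmf G k > 0" "k = k0 G"
    "measure_pmf.prob G {..<k} + r * pmf G k = 1/2" "umed G = real k - 1/2 + r"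
proof -
  define k where "k = k0 G"
  have ge: "measure_pmf.prob G {..k} \<ge> 1/2"
    unfolding k_def k0_def using prob_atMost_gt_half[of G] by (metis (mono_tags, lifting) LeastI less_imp_le)
  have less: "measure_pmf.prob G {..<k} < 1/2"
  proof (cases k)
    case (Suc j)
    then have "\<not> measure_pmf.prob G {..j} \<ge> 1/2"
      using not_less_Least[of j "\<lambda>k. measure_pmf.prob G {..k} \<ge> 1/2"] by (simp add: k_def k0_def)
    then show ?thesis using Suc by (simp add: lessThan_Suc_atMost)
  qed simp
  have p: "pmf G k > 0" using ge less by (simp add: prob_atMost_eq)
  show thesis
    using ge less p
    by (intro that[of "(1/2 - measure_pmf.prob G {..<k}) / pmf G k" k])
       (auto simp: prob_atMost_eq umed_def k_def[symmetric])
qed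

section \<open>Huber's function and its estimating equation\<close>

definition huber :: "real \<Rightarrow> nat \<Rightarrow> real" where
  "huber m x = max (- 1/2) (min (1/2) (real x - m))"

lemma abs_huber_le: "\<bar>huber m x\<bar> \<le> 1/2"
  unfolding huber_def by linarith

lemma integrable_bounded_pmf:
  assumes "\<And>x. x \<in> set_pmf p \<Longrightarrow> \<bar>f x\<bar> \<le> (B::real)"
  shows "integrable (measure_pmf p) f"
  by (rule measure_pmf.integrable_const_bound[of _ B]) (use assms in \<open>auto simp: AE_measure_pmf_iff\<close>)

lemma integrable_huber: "integrable (measure_pmf p) (huber m)"
  by (rule integrable_bounded_pmf[of _ _ "1/2"]) (rule abs_huber_le)

text \<open>Neighbouring integers differ by 1, the width of the unclipped range, so only
  \<open>k\<close> can take an intermediate value.\<close>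

lemma huber_at:
  assumes "0 < r" "r \<le> 1"
  shows "huber (real k - 1/2 + r) x = (if x < k then - 1/2 else if x = k then 1/2 - r else 1/2)"
proof -
  consider "real x + 1 \<le> real k" "x < k" | "x = k" | "real x \<ge> real k + 1" "x > k"
    by linarith
  then show ?thesis using assms by cases (auto simp: huber_def)
qed

lemma expectation_huber_at:
  assumes "0 < r" "r \<le> 1"
  shows "measure_pmf.expectation G (huber (real k - 1/2 + r)) =
    1/2 - (measure_pmf.prob G {..<k} + r * pmf G k)"
proof -
  have "huber (real k - 1/2 + r) = (\<lambda>x. 1/2 - (indicator {..<k} x + r * indicator {k} x))"
    using assms by (auto simp: huber_at fun_eq_iff)
  moreover have "integrable (measure_pmf G) (\<lambda>x. r * indicator {k} x :: real)"
    "integrable (measure_pmf G) (\<lambda>x. indicator {..<k} x :: real)"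
    by (auto intro!: integrable_bounded_pmf[of _ _ "\<bar>r\<bar>"] integrable_bounded_pmf[of _ _ 1] simp: indicator_def)
  ultimately show ?thesis by (simp add: measure_pmf_single)
qed

lemma expectation_huber_umed: "measure_pmf.expectation G (huber (umed G)) = 0"
proof (rule umed_cases[of G])
  fix k r assume "0 < r" "r \<le> 1" "measure_pmf.prob G {..<k} + r * pmf G k = 1/2" "umed G = real k - 1/2 + r"
  then show ?thesis by (simp add: expectation_huber_at)
qed

text \<open>If \<open>G\<close> has no mass at \<open>k\<close> and mass 1/2 below it, the equation
  holds for every \<open>r\<close> and does not determine the median. The second assumption excludes
  this at \<open>k0 P\<close>.\<close>

lemma umed_eq_of_expectation_huber:
  assumes "measure_pmf.expectation G (huber (umed P)) = 0"
    and "\<And>k. k \<in> set_pmf P \<Longrightarrow> pmf G k = 0 \<Longrightarrow> measure_pmf.prob G {..<k} \<noteq> 1/2"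
  shows "umed G = umed P"
proof (rule umed_cases[of P])
  fix k r assume kr: "0 < r" "r \<le> 1" "umed P = real k - 1/2 + r" "pmf P k > 0"
  then have eq: "measure_pmf.prob G {..<k} + r * pmf G k = 1/2"
    using assms(1) by (simp add: expectation_huber_at)
  moreover have "pmf G k \<noteq> 0"
    using assms(2)[of k] eq kr(4) by (auto simp: set_pmf_iff)
  ultimately show ?thesis using kr umed_eqI by simp
qed

text \<open>The right-hand side avoids \<open>k0\<close>, which jumps as \<open>G\<close> varies.
  For fixed \<open>x\<close> it depends continuously on the finitely many masses up to
  \<open>x\<close>; this gives continuity of \<open>psi0\<close> in the parameter.\<close>

lemma huber_umed_eq:
  assumes "pmf G x > 0"
  shows "huber (umed G) x =
    max (- 1/2) (min (1/2) (1/2 - (1/2 - measure_pmf.prob G {..<x}) / pmf G x))"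
proof (rule umed_cases[of G])
  fix k r assume kr: "0 < r" "r \<le> 1" "umed G = real k - 1/2 + r" "pmf G k > 0"
    "measure_pmf.prob G {..<k} + r * pmf G k = 1/2"
  consider "x < k" | "x = k" | "x > k" by linarith
  then show ?thesis
  proof cases
    case 1
    have "measure_pmf.prob G {..x} \<le> measure_pmf.prob G {..<k}"
      using 1 by (intro measure_pmf.finite_measure_mono) auto
    moreover have "r * pmf G k \<ge> 0" using kr by simp
    ultimately have "(1/2 - measure_pmf.prob G {..<x}) / pmf G x \<ge> 1"
      using kr(5) assms by (simp add: prob_atMost_eq le_divide_eq)
    then show ?thesis using kr 1 by (simp add: huber_at)
  next
    case 2
    have "(1/2 - measure_pmf.prob G {..<x}) / pmf G x = r"
      using kr(5) assms 2 by (simp add: field_simps)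
    then show ?thesis using kr 2 by (simp add: huber_at)
  next
    case 3
    have "measure_pmf.prob G {..k} \<le> measure_pmf.prob G {..<x}"
      using 3 by (intro measure_pmf.finite_measure_mono) auto
    moreover have "r * pmf G k \<le> 1 * pmf G k" using kr by (intro mult_right_mono) auto
    ultimately have "(1/2 - measure_pmf.prob G {..<x}) / pmf G x \<le> 0"
      using kr(5) assms by (simp add: prob_atMost_eq divide_nonpos_pos)
    then show ?thesis using kr 3 by (simp add: huber_at)
  qed
qed

lemma huber_umed_eq_half:
  assumes "measure_pmf.prob G {..K} \<ge> 1/2" "x > K"
  shows "huber (umed G) x = 1/2"
proof (rule umed_cases[of G])
  fix k r assume kr: "0 < r" "r \<le> 1" "umed G = real k - 1/2 + r" "k = k0 G"
  have "k \<le> K" unfolding kr(4) k0_def by (rule Least_le) (rule assms(1))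
  then show ?thesis using kr assms(2) by (simp add: huber_at)
qed

text \<open>Beyond \<open>K\<close> Huber's function is constantly 1/2, so after subtracting 1/2 its
  mean is a finite sum, with the same \<open>K\<close> for every \<open>P\<close>. Subtracting the
  identity for \<open>G\<close>, where the mean is 0, leaves differences of masses.\<close>

lemma expectation_huber_umed_finite:
  assumes "measure_pmf.prob G {..K} \<ge> 1/2"
  shows "measure_pmf.expectation P (huber (umed G)) =
    (\<Sum>x\<le>K. (pmf P x - pmf G x) * (huber (umed G) x - 1/2))"
proof -
  have *: "measure_pmf.expectation Q (huber (umed G)) =
      1/2 + (\<Sum>x\<le>K. pmf Q x * (huber (umed G) x - 1/2))" for Q
  proof -
    have "measure_pmf.expectation Q (\<lambda>x. huber (umed G) x - 1/2) =
        (\<Sum>x\<le>K. pmf Q x * (huber (umed G) x - 1/2))"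
      using huber_umed_eq_half[OF assms]
      by (subst integral_measure_pmf_real[of "{..K}"]) (auto simp: mult.commute intro: leI)
    then show ?thesis by (simp add: integrable_huber)
  qed
  show ?thesis
    using *[of P] *[of G] expectation_huber_umed[of G]
    by (simp add: left_diff_distrib sum_subtractf)
qed

section \<open>Contaminated distributions\<close>

lemma expectation_contaminate:
  assumes "0 \<le> \<epsilon>" "\<epsilon> \<le> 1" "integrable (measure_pmf G) f" "integrable (measure_pmf (contaminate \<epsilon> x G)) f"
  shows "measure_pmf.expectation (contaminate \<epsilon> x G) f =
    (1 - \<epsilon>) * measure_pmf.expectation G f + \<epsilon> * (f x :: real)"
proof -
  have "(\<lambda>n. (1 - \<epsilon>) * (pmf G n * f n) + \<epsilon> * (if n = x then f n else 0)) sums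
      ((1 - \<epsilon>) * measure_pmf.expectation G f + \<epsilon> * f x)"
    by (intro sums_add sums_mult sums_expectation_pmf sums_single assms)
  moreover have "(1 - \<epsilon>) * (pmf G n * f n) + \<epsilon> * (if n = x then f n else 0) =
      pmf (contaminate \<epsilon> x G) n * f n" for n
    using assms by (simp add: pmf_contaminate algebra_simps)
  ultimately show ?thesis
    using sums_expectation_pmf[OF assms(4)] by (simp add: sums_iff)
qed

text \<open>Ensures that contamination at a point of the support creates no point without mass at
  which the median equation would be ambiguous.\<close>

lemma set_pmf_contaminate:
  assumes "0 \<le> \<epsilon>" "\<epsilon> < 1" "x \<in> set_pmf G"
  shows "set_pmf (contaminate \<epsilon> x G) = set_pmf G"
proof -
  have "pmf (contaminate \<epsilon> x G) k = 0 \<longleftrightarrow> pmf G k = 0" for k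
    using assms by (auto simp: pmf_contaminate indicator_def set_pmf_iff add_nonneg_eq_0_iff)
  then show ?thesis by (auto simp: set_pmf_iff)
qed

section \<open>Derivatives\<close>

text \<open>Where \<open>f\<close> vanishes, the increment of \<open>g\<close> enters only
  multiplied by a first-order quantity, so continuity of \<open>g\<close> suffices. The remainder is
  the error of \<open>f\<close> times \<open>g\<close> plus \<open>f'\<close> times the increment of
  \<open>g\<close>.\<close>

lemma has_derivative_mult_vanishing:
  fixes f g :: "'a::real_normed_vector \<Rightarrow> real"
  assumes f: "(f has_derivative f') (at z)" "f z = 0" and g: "isCont g z"
  shows "((\<lambda>y. f y * g y) has_derivative (\<lambda>v. f' v * g z)) (at z)"
proof -
  have bl: "bounded_linear f'" using f(1) by (rule has_derivative_bounded_linear)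
  obtain B where B: "\<And>v. \<bar>f' v\<bar> \<le> norm v * B" 
    using bounded_linear.bounded[OF bl] by auto
  have f0: "((\<lambda>y. (f y - f' (y - z)) / norm (y - z)) \<longlongrightarrow> 0) (at z)"
    using f by (simp add: has_derivative_at2 divide_inverse mult.commute)
  have g0: "((\<lambda>y. g y - g z) \<longlongrightarrow> 0) (at z)"
    using g by (simp add: isCont_def LIM_zero)
  have "((\<lambda>y. f' (y - z) * (g y - g z) / norm (y - z)) \<longlongrightarrow> 0) (at z)"
  proof (rule tendsto_0_le[OF g0, of _ B], rule always_eventually, rule allI)
    fix y
    have "\<bar>f' (y - z)\<bar> * \<bar>g y - g z\<bar> \<le> norm (y - z) * B * \<bar>g y - g z\<bar>"
      by (intro mult_right_mono B) auto
    then show "norm (f' (y - z) * (g y - g z) / norm (y - z)) \<le> norm (g y - g z) * B"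
      by (cases "y = z") (auto simp: abs_mult divide_le_eq mult_ac)
  qed
  moreover have "((\<lambda>y. (f y - f' (y - z)) / norm (y - z) * g y) \<longlongrightarrow> 0 * g z) (at z)"
    using f0 g by (intro tendsto_mult) (auto simp: isCont_def)
  ultimately have "((\<lambda>y. (f y - f' (y - z)) / norm (y - z) * g y +
      f' (y - z) * (g y - g z) / norm (y - z)) \<longlongrightarrow> 0 * g z + 0) (at z)"
    by (intro tendsto_add)
  moreover have "(f y - f' (y - z)) / norm (y - z) * g y + f' (y - z) * (g y - g z) / norm (y - z)
      = (1 / norm (y - z)) *\<^sub>R (f y * g y - (f z * g z + f' (y - z) * g z))" for y
    using f(2) by (simp add: divide_inverse algebra_simps)
  ultimately show ?thesis
    unfolding has_derivative_at2 using bl by (simp only: bounded_linear_mult_const mult_zero_left add_0_left)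
qed

text \<open>\<open>\<sigma> * D\<close> is the slope in the direction \<open>\<sigma>\<close>; were
  it negative, \<open>f\<close> would drop below 0 immediately on that side.\<close>

lemma DERIV_nonneg_one_sided:
  fixes f :: "real \<Rightarrow> real"
  assumes der: "(f has_real_derivative D) (at \<theta>)" and "f \<theta> = 0" and \<sigma>: "\<sigma> = 1 \<or> \<sigma> = -1"
    and ev: "\<forall>\<^sub>F t in nhds \<theta>. \<sigma> * \<theta> < \<sigma> * t \<longrightarrow> f t \<ge> 0"
  shows "\<sigma> * D \<ge> 0"
proof (rule ccontr)
  assume neg: "\<not> \<sigma> * D \<ge> 0"
  obtain e where e: "e > 0" "\<And>t. dist t \<theta> < e \<Longrightarrow> \<sigma> * \<theta> < \<sigma> * t \<Longrightarrow> f t \<ge> 0"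
    using ev by (auto simp: eventually_nhds_metric)
  show False using \<sigma>
  proof
    assume s: "\<sigma> = 1"
    then obtain d where d: "d > 0" "\<And>h. 0 < h \<Longrightarrow> h < d \<Longrightarrow> f (\<theta> + h) < f \<theta>"
      using DERIV_neg_dec_right[OF der] neg by auto
    obtain h where "0 < h" "h < d" "h < e" using d(1) e(1) by (meson dense min_less_iff_conj)
    then show False using d(2)[of h] e(2)[of "\<theta> + h"] s \<open>f \<theta> = 0\<close> by (simp add: dist_real_def)
  next
    assume s: "\<sigma> = -1"
    then obtain d where d: "d > 0" "\<And>h. 0 < h \<Longrightarrow> h < d \<Longrightarrow> f (\<theta> - h) < f \<theta>"
      using DERIV_pos_inc_left[OF der] neg by auto
    obtain h where "0 < h" "h < d" "h < e" using d(1) e(1) by (meson dense min_less_iff_conj)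
    then show False using d(2)[of h] e(2)[of "\<theta> - h"] s \<open>f \<theta> = 0\<close> by (simp add: dist_real_def)
  qed
qed

text \<open>The derivative along the diagonal is the sum of the two partial derivatives, and it is 0
  because the function vanishes there. Fisher consistency supplies the vanishing.\<close>

lemma partial_derivs_opposite:
  fixes \<Lambda> :: "real \<Rightarrow> real \<Rightarrow> real"
  assumes "(\<lambda>(\<theta>', t). \<Lambda> \<theta>' t) differentiable (at (\<theta>, \<theta>))"
    and diag: "\<forall>\<^sub>F t in nhds \<theta>. \<Lambda> t t = 0"
  obtains l where "((\<lambda>t. \<Lambda> t \<theta>) has_real_derivative l) (at \<theta>)"
    "((\<lambda>t. \<Lambda> \<theta> t) has_real_derivative - l) (at \<theta>)"
proof -
  obtain L where L: "((\<lambda>(\<theta>', t). \<Lambda> \<theta>' t) has_derivative L) (at (\<theta>, \<theta>))"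
    using assms(1) by (auto simp: differentiable_def)
  interpret bounded_linear L using L by (rule has_derivative_bounded_linear)
  have scl: "L (a * h, b * h) = L (a, b) * h" for a b h
    using scaleR[of h "(a, b)"] by (simp only: scaleR_Pair real_scaleR_def mult.commute)
  \<comment> \<open>Chain rule along a curve through the diagonal point with velocity
    \<open>(a, b)\<close>; it is applied to the two coordinate lines and to the diagonal.\<close>
  have gen: "((\<lambda>t. \<Lambda> (fst (g t)) (snd (g t))) has_real_derivative L (a, b)) (at \<theta>)"
    if g: "(g has_derivative (\<lambda>h. (a * h, b * h))) (at \<theta>)" "g \<theta> = (\<theta>, \<theta>)" for g a b
    using has_derivative_compose[OF g(1), of "\<lambda>(\<theta>', t). \<Lambda> \<theta>' t" L] L g(2)
    by (simp add: has_field_derivative_def scl case_prod_unfold)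
  have d1: "((\<lambda>t. \<Lambda> t \<theta>) has_real_derivative L (1, 0)) (at \<theta>)"
  proof -
    have "((\<lambda>t. (t, \<theta>)) has_derivative (\<lambda>h. (1 * h, 0 * h))) (at \<theta>)"
      by (auto intro!: derivative_eq_intros)
    from gen[OF this] show ?thesis by simp
  qed
  have d2: "((\<lambda>t. \<Lambda> \<theta> t) has_real_derivative L (0, 1)) (at \<theta>)"
  proof -
    have "((\<lambda>t. (\<theta>, t)) has_derivative (\<lambda>h. (0 * h, 1 * h))) (at \<theta>)"
      by (auto intro!: derivative_eq_intros)
    from gen[OF this] show ?thesis by simp
  qed
  have d3: "((\<lambda>t. \<Lambda> t t) has_real_derivative L (1, 1)) (at \<theta>)"
  proof -
    have "((\<lambda>t. (t, t)) has_derivative (\<lambda>h. (1 * h, 1 * h))) (at \<theta>)"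
      by (auto intro!: derivative_eq_intros)
    from gen[OF this] show ?thesis by simp
  qed
  have "((\<lambda>t. \<Lambda> t t) has_real_derivative 0) (at \<theta>)"
    using DERIV_cong_ev[OF refl diag refl] by simp
  then have "L (1, 1) = 0" using d3 DERIV_unique by blast
  then have "L (0, 1) = - L (1, 0)" using add[of "(1, 0)" "(0, 1)"] by simp
  then show thesis using that d1 d2 by simp
qed

section \<open>Families with monotone likelihood ratio\<close>

text \<open>The sign \<open>\<sigma>\<close> tells whether the score increases or decreases in \<open>x\<close>.\<close>

locale mlr_family =
  fixes F :: "real \<Rightarrow> nat pmf" and \<Theta> :: "real set" and S :: "nat set"
    and \<sigma> :: real and s :: "nat \<Rightarrow> real \<Rightarrow> real"
  assumes open_params: "open \<Theta>"
    and support: "\<And>\<theta>. \<theta> \<in> \<Theta> \<Longrightarrow> set_pmf (F \<theta>) = S"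
    and two_points: "\<And>k. \<exists>x\<in>S. x \<noteq> k"
    and sigma: "\<sigma> = 1 \<or> \<sigma> = -1"
    and deriv_pmf: "\<And>x \<theta>. x \<in> S \<Longrightarrow> \<theta> \<in> \<Theta> \<Longrightarrow>
      ((\<lambda>t. pmf (F t) x) has_real_derivative pmf (F \<theta>) x * s x \<theta>) (at \<theta>)"
    and score_mono: "\<And>x y \<theta>. \<theta> \<in> \<Theta> \<Longrightarrow> x \<in> S \<Longrightarrow> y \<in> S \<Longrightarrow> x < y \<Longrightarrow> \<sigma> * s x \<theta> < \<sigma> * s y \<theta>"
    and mlr: "\<And>\<theta> \<theta>' x y. \<theta> \<in> \<Theta> \<Longrightarrow> \<theta>' \<in> \<Theta> \<Longrightarrow> \<sigma> * \<theta> < \<sigma> * \<theta>' \<Longrightarrow> x \<in> S \<Longrightarrow> y \<in> S \<Longrightarrow> x < y \<Longrightarrow>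
      pmf (F \<theta>') x * pmf (F \<theta>) y < pmf (F \<theta>') y * pmf (F \<theta>) x"
begin

section \<open>The estimating function of the uniform median\<close>

definition psi0 :: "nat \<Rightarrow> real \<Rightarrow> real" where
  "psi0 x t = huber (umed (F t)) x"

lemma psi0_conv: "(\<lambda>x. psi0 x t) = huber (umed (F t))"
  by (simp add: psi0_def fun_eq_iff)

lemma abs_psi0_le: "\<bar>psi0 x t\<bar> \<le> 1/2"
  unfolding psi0_def by (rule abs_huber_le)

lemma expectation_psi0: "measure_pmf.expectation (F t) (\<lambda>x. psi0 x t) = 0"
  by (simp add: psi0_conv expectation_huber_umed)

lemma integrable_psi0: "integrable (measure_pmf p) (\<lambda>x. psi0 x t)"
  by (simp add: psi0_conv integrable_huber)

lemma pmf_pos: "\<theta> \<in> \<Theta> \<Longrightarrow> x \<in> S \<Longrightarrow> pmf (F \<theta>) x > 0"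
  using support by (metis pmf_positive)

lemma pmf_zero: "\<theta> \<in> \<Theta> \<Longrightarrow> x \<notin> S \<Longrightarrow> pmf (F \<theta>) x = 0"
  using support by (metis set_pmf_iff)

lemma eventually_params: "\<theta> \<in> \<Theta> \<Longrightarrow> \<forall>\<^sub>F t in nhds \<theta>. t \<in> \<Theta>"
  using open_params by (rule eventually_nhds_in_open)

lemma psi0_side:
  "x < k0 (F t) \<Longrightarrow> psi0 x t = - 1/2" "k0 (F t) < x \<Longrightarrow> psi0 x t = 1/2"
  by (rule umed_cases[of "F t"]; simp add: psi0_def huber_at)+

lemma k0_in: "t \<in> \<Theta> \<Longrightarrow> k0 (F t) \<in> S"
  by (rule umed_cases[of "F t"]) (auto simp: set_pmf_iff simp flip: support)

section \<open>Domination of bounded estimating functions by \<open>psi0\<close>\<close>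

lemma likelihood_sign:
  assumes "\<theta> \<in> \<Theta>" "\<theta>' \<in> \<Theta>" "\<sigma> * \<theta> < \<sigma> * \<theta>'" "x \<in> S" "k \<in> S"
  shows "x < k \<Longrightarrow> pmf (F \<theta>') x * pmf (F \<theta>) k - pmf (F \<theta>') k * pmf (F \<theta>) x < 0"
    and "k < x \<Longrightarrow> pmf (F \<theta>') x * pmf (F \<theta>) k - pmf (F \<theta>') k * pmf (F \<theta>) x > 0"
  using mlr[of \<theta> \<theta>' x k] mlr[of \<theta> \<theta>' k x] assms by (auto simp: mult.commute)

text \<open>Off \<open>k\<close>, \<open>2 * M * psi0\<close> is \<open>- M\<close> on the left and
  \<open>M\<close> on the right, so \<open>d\<close> is nonpositive on the left and nonnegative on
  the right, matching the likelihood weight. At \<open>k\<close> the weight is 0. Hence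
  \<open>expectation_terms_le\<close> applies.\<close>

lemma dominated_by_psi0:
  assumes \<theta>: "\<theta> \<in> \<Theta>" and M: "\<And>y. y \<in> S \<Longrightarrow> \<bar>\<psi> y\<bar> \<le> M"
    and E0: "measure_pmf.expectation (F \<theta>) \<psi> = 0"
    and \<theta>': "\<theta>' \<in> \<Theta>" "\<sigma> * \<theta> < \<sigma> * \<theta>'" and x: "x \<in> S"
  defines "k \<equiv> k0 (F \<theta>)" and "d \<equiv> (\<lambda>y. 2 * M * psi0 y \<theta> - \<psi> y)"
  shows "0 \<le> (pmf (F \<theta>') x * pmf (F \<theta>) k - pmf (F \<theta>') k * pmf (F \<theta>) x) * d x"
    and "(pmf (F \<theta>') x * pmf (F \<theta>) k - pmf (F \<theta>') k * pmf (F \<theta>) x) * d x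
      \<le> pmf (F \<theta>) k * (2 * M * measure_pmf.expectation (F \<theta>') (\<lambda>y. psi0 y \<theta>)
          - measure_pmf.expectation (F \<theta>') \<psi>)"
proof -
  have k: "k \<in> S" using \<theta> by (simp add: k_def k0_in)
  have int: "integrable (measure_pmf (F t)) \<psi>" if "t \<in> \<Theta>" for t
    using M that by (intro integrable_bounded_pmf[of _ _ M]) (simp add: support)
  have nn: "0 \<le> (pmf (F \<theta>') y * pmf (F \<theta>) k - pmf (F \<theta>') k * pmf (F \<theta>) y) * d y" if "y \<in> S" for y
  proof -
    consider "y < k" | "y = k" | "y > k" by linarith
    then show ?thesis
    proof cases
      case 1
      then have "d y \<le> 0" using M[OF that] by (simp add: d_def psi0_side k_def)
      then show ?thesis using likelihood_sign(1)[OF \<theta> \<theta>' that k 1] by (simp add: mult_nonpos_nonpos)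
    next
      case 3
      then have "d y \<ge> 0" using M[OF that] by (simp add: d_def psi0_side k_def)
      then show ?thesis using likelihood_sign(2)[OF \<theta> \<theta>' that k 3] by simp
    qed simp
  qed
  show "0 \<le> (pmf (F \<theta>') x * pmf (F \<theta>) k - pmf (F \<theta>') k * pmf (F \<theta>) x) * d x"
    by (rule nn[OF x])
  have "(pmf (F \<theta>') x * pmf (F \<theta>) k - pmf (F \<theta>') k * pmf (F \<theta>) x) * d x
      \<le> pmf (F \<theta>) k * measure_pmf.expectation (F \<theta>') d"
    using int \<theta> \<theta>' nn E0
    by (intro expectation_terms_le) (auto simp: d_def integrable_psi0 expectation_psi0 support)
  then show "(pmf (F \<theta>') x * pmf (F \<theta>) k - pmf (F \<theta>') k * pmf (F \<theta>) x) * d x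
      \<le> pmf (F \<theta>) k * (2 * M * measure_pmf.expectation (F \<theta>') (\<lambda>y. psi0 y \<theta>)
          - measure_pmf.expectation (F \<theta>') \<psi>)"
    using int \<theta>' by (simp add: d_def integrable_psi0)
qed

text \<open>The first claim is domination with \<open>\<psi> = 0\<close> and \<open>M = 1/2\<close>;
  the second is its mirror image, with the parameters exchanged and \<open>- psi0\<close> for
  \<open>psi0\<close>. A point of \<open>S\<close> other than \<open>k\<close> makes both
  strict.\<close>

lemma expectation_psi0_sign:
  assumes \<theta>: "\<theta> \<in> \<Theta>" "\<theta>' \<in> \<Theta>" and lt: "\<sigma> * \<theta> < \<sigma> * \<theta>'"
  shows "measure_pmf.expectation (F \<theta>') (\<lambda>y. psi0 y \<theta>) > 0"
    and "measure_pmf.expectation (F \<theta>) (\<lambda>y. psi0 y \<theta>') < 0"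
proof -
  define k where "k = k0 (F \<theta>)"
  have k: "k \<in> S" using \<theta> by (simp add: k_def k0_in)
  obtain x where x: "x \<in> S" "x \<noteq> k" using two_points by blast
  have "(pmf (F \<theta>') x * pmf (F \<theta>) k - pmf (F \<theta>') k * pmf (F \<theta>) x) * psi0 x \<theta> > 0"
    using likelihood_sign[OF \<theta> lt x(1) k] x(2) psi0_side[where x = x and t = \<theta>]
    by (cases "x < k") (auto simp: k_def mult_neg_neg)
  moreover have "(pmf (F \<theta>') x * pmf (F \<theta>) k - pmf (F \<theta>') k * pmf (F \<theta>) x) * psi0 x \<theta>
      \<le> pmf (F \<theta>) k * measure_pmf.expectation (F \<theta>') (\<lambda>y. psi0 y \<theta>)"
    using dominated_by_psi0(2)[where \<psi> = "\<lambda>_. 0" and M = "1/2", OF \<theta>(1) _ _ \<theta>(2) lt x(1)] by (simp add: k_def)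
  ultimately have "0 < pmf (F \<theta>) k * measure_pmf.expectation (F \<theta>') (\<lambda>y. psi0 y \<theta>)"
    by (rule less_le_trans)
  then show "measure_pmf.expectation (F \<theta>') (\<lambda>y. psi0 y \<theta>) > 0"
    using pmf_pos[OF \<theta>(1) k] by (rule zero_less_mult_pos)
next
  define k where "k = k0 (F \<theta>')"
  have k: "k \<in> S" using \<theta> by (simp add: k_def k0_in)
  have sgn: "(pmf (F \<theta>) x * pmf (F \<theta>') k - pmf (F \<theta>) k * pmf (F \<theta>') x) * - psi0 x \<theta>' > 0"
    if "x \<in> S" "x \<noteq> k" for x
    using likelihood_sign[OF \<theta> lt k that(1)] that(2) psi0_side[where x = x and t = \<theta>']
    by (cases "x < k") (auto simp: k_def algebra_simps)
  obtain x where x: "x \<in> S" "x \<noteq> k" using two_points by blast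
  have "(pmf (F \<theta>) x * pmf (F \<theta>') k - pmf (F \<theta>) k * pmf (F \<theta>') x) * - psi0 x \<theta>'
      \<le> pmf (F \<theta>') k * measure_pmf.expectation (F \<theta>) (\<lambda>y. - psi0 y \<theta>')"
  proof (rule expectation_terms_le)
    fix y assume "y \<in> set_pmf (F \<theta>') \<union> set_pmf (F \<theta>)"
    then show "0 \<le> (pmf (F \<theta>) y * pmf (F \<theta>') k - pmf (F \<theta>) k * pmf (F \<theta>') y) * - psi0 y \<theta>'"
      using sgn[of y] \<theta> by (cases "y = k") (auto simp: support)
  qed (auto simp: integrable_psi0 expectation_psi0)
  with sgn[OF x] have "0 < pmf (F \<theta>') k * measure_pmf.expectation (F \<theta>) (\<lambda>y. - psi0 y \<theta>')"
    by (rule less_le_trans)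
  then have "0 < measure_pmf.expectation (F \<theta>) (\<lambda>y. - psi0 y \<theta>')"
    using pmf_pos[OF \<theta>(2) k] by (rule zero_less_mult_pos)
  then show "measure_pmf.expectation (F \<theta>) (\<lambda>y. psi0 y \<theta>') < 0"
    by simp
qed

text \<open>Equal medians give the same \<open>psi0\<close>, so its mean at the other parameter
  would be 0, against the strict sign.\<close>

lemma umed_inj:
  assumes "\<theta> \<in> \<Theta>" "\<theta>' \<in> \<Theta>" "umed (F \<theta>) = umed (F \<theta>')"
  shows "\<theta> = \<theta>'"
proof (rule ccontr)
  assume "\<theta> \<noteq> \<theta>'"
  then have "\<sigma> * \<theta> < \<sigma> * \<theta>' \<or> \<sigma> * \<theta>' < \<sigma> * \<theta>" using sigma by auto
  then show False
    using expectation_psi0_sign(1)[OF assms(1,2)] expectation_psi0_sign(1)[OF assms(2,1)]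
      expectation_psi0[of \<theta>] expectation_psi0[of \<theta>'] assms(3) by (auto simp: psi0_conv)
qed

lemma umed_est_eq: "t \<in> \<Theta> \<Longrightarrow> umed G = umed (F t) \<Longrightarrow> umed_est F \<Theta> G = t"
  unfolding umed_est_def by (rule the_equality) (auto intro: umed_inj)

section \<open>Continuity and differentiability of the expectation of \<open>psi0\<close>\<close>

lemma deriv_pmf':
  assumes "\<theta> \<in> \<Theta>"
  obtains D where "((\<lambda>t. pmf (F t) x) has_real_derivative D) (at \<theta>)"
proof (cases "x \<in> S")
  case False
  have "\<forall>\<^sub>F t in nhds \<theta>. pmf (F t) x = 0"
    using eventually_params[OF assms] by eventually_elim (simp add: pmf_zero False)
  then have "((\<lambda>t. pmf (F t) x) has_real_derivative 0) (at \<theta>)"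
    by (simp add: DERIV_cong_ev[OF refl _ refl, where g = "\<lambda>_. 0"])
  then show ?thesis by (rule that)
qed (use deriv_pmf assms that in blast)

lemma isCont_pmf: "\<theta> \<in> \<Theta> \<Longrightarrow> isCont (\<lambda>t. pmf (F t) x) \<theta>"
  by (rule deriv_pmf'[of \<theta> x]) (auto intro: DERIV_isCont)

lemma isCont_prob: "\<theta> \<in> \<Theta> \<Longrightarrow> finite A \<Longrightarrow> isCont (\<lambda>t. measure_pmf.prob (F t) A) \<theta>"
  by (simp add: measure_measure_pmf_finite isCont_pmf)

lemma isCont_psi0:
  assumes "\<theta> \<in> \<Theta>" "x \<in> S"
  shows "isCont (psi0 x) \<theta>"
proof -
  have "\<forall>\<^sub>F t in nhds \<theta>. psi0 x t =
      max (- 1/2) (min (1/2) (1/2 - (1/2 - measure_pmf.prob (F t) {..<x}) / pmf (F t) x))"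
    using eventually_params[OF assms(1)]
    by eventually_elim (simp add: psi0_def huber_umed_eq pmf_pos assms)
  moreover have "isCont (\<lambda>t. max (- 1/2)
      (min (1/2) (1/2 - (1/2 - measure_pmf.prob (F t) {..<x}) / pmf (F t) x))) \<theta>"
    using pmf_pos[OF assms] assms by (intro continuous_intros isCont_prob isCont_pmf) auto
  ultimately show ?thesis by (subst isCont_cong)
qed

text \<open>
  Subtracting \<open>E\<^bsub>t\<^esub> \<psi>\<^sub>0(x, t) = 0\<close> produces factors that vanish on the diagonal. Hence differentiability
  needs only continuity of \<open>\<psi>\<^sub>0(x, \<cdot>)\<close>, which has kinks.
\<close>

lemma expectation_psi0_finite:
  assumes "\<theta> \<in> \<Theta>"
  obtains K where "\<forall>\<^sub>F t in nhds \<theta>. \<forall>\<theta>'\<in>\<Theta>. measure_pmf.expectation (F \<theta>') (\<lambda>x. psi0 x t) =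
    (\<Sum>x\<in>{..K} \<inter> S. (pmf (F \<theta>') x - pmf (F t) x) * (psi0 x t - 1/2))"
proof -
  \<comment> \<open>The strict inequality persists for \<open>t\<close> near
    \<open>\<theta>\<close>, so one \<open>K\<close> serves a whole neighbourhood.\<close>
  obtain K where K: "measure_pmf.prob (F \<theta>) {..K} > 1/2"
    using prob_atMost_gt_half by blast
  have "((\<lambda>t. measure_pmf.prob (F t) {..K}) \<longlongrightarrow> measure_pmf.prob (F \<theta>) {..K}) (nhds \<theta>)"
    using isCont_prob[OF assms, of "{..K}"]
      tendsto_at_iff_tendsto_nhds[of "\<lambda>t. measure_pmf.prob (F t) {..K}" \<theta>]
    by (simp add: isCont_def)
  then have "\<forall>\<^sub>F t in nhds \<theta>. measure_pmf.prob (F t) {..K} > 1/2"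
    using K by (rule order_tendstoD)
  then have "\<forall>\<^sub>F t in nhds \<theta>. \<forall>\<theta>'\<in>\<Theta>. measure_pmf.expectation (F \<theta>') (\<lambda>x. psi0 x t) =
    (\<Sum>x\<in>{..K} \<inter> S. (pmf (F \<theta>') x - pmf (F t) x) * (psi0 x t - 1/2))"
    using eventually_params[OF assms]
  proof eventually_elim
    case (elim t)
    show ?case
    proof
      fix \<theta>' assume "\<theta>' \<in> \<Theta>"
      have "measure_pmf.expectation (F \<theta>') (\<lambda>x. psi0 x t) =
          (\<Sum>x\<le>K. (pmf (F \<theta>') x - pmf (F t) x) * (psi0 x t - 1/2))"
        using elim by (simp add: psi0_conv expectation_huber_umed_finite psi0_def)
      \<comment> \<open>Points outside \<open>S\<close> carry no mass; the remaining ones are those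
        where \<open>psi0\<close> is known to be continuous.\<close>
      also have "\<dots> = (\<Sum>x\<in>{..K} \<inter> S. (pmf (F \<theta>') x - pmf (F t) x) * (psi0 x t - 1/2))"
        using elim \<open>\<theta>' \<in> \<Theta>\<close> by (intro sum.mono_neutral_right) (auto simp: pmf_zero)
      finally show "measure_pmf.expectation (F \<theta>') (\<lambda>x. psi0 x t) =
          (\<Sum>x\<in>{..K} \<inter> S. (pmf (F \<theta>') x - pmf (F t) x) * (psi0 x t - 1/2))" .
    qed
  qed
  then show thesis by (rule that)
qed

text \<open>Locally in \<open>t\<close> this is a finite sum of continuous functions, also away from
  the diagonal, as the intermediate value argument for the estimator requires.\<close>

lemma isCont_expectation_psi0:
  assumes "\<theta> \<in> \<Theta>" "\<theta>' \<in> \<Theta>"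
  shows "isCont (\<lambda>t. measure_pmf.expectation (F \<theta>') (\<lambda>x. psi0 x t)) \<theta>"
proof (rule expectation_psi0_finite[OF assms(1)])
  fix K assume "\<forall>\<^sub>F t in nhds \<theta>. \<forall>\<theta>'\<in>\<Theta>. measure_pmf.expectation (F \<theta>') (\<lambda>x. psi0 x t) =
    (\<Sum>x\<in>{..K} \<inter> S. (pmf (F \<theta>') x - pmf (F t) x) * (psi0 x t - 1/2))"
  then have "\<forall>\<^sub>F t in nhds \<theta>. measure_pmf.expectation (F \<theta>') (\<lambda>x. psi0 x t) =
    (\<Sum>x\<in>{..K} \<inter> S. (pmf (F \<theta>') x - pmf (F t) x) * (psi0 x t - 1/2))"
    by eventually_elim (use assms in blast)
  moreover have "isCont (\<lambda>t. \<Sum>x\<in>{..K} \<inter> S. (pmf (F \<theta>') x - pmf (F t) x) * (psi0 x t - 1/2)) \<theta>"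
    using assms by (intro continuous_intros isCont_psi0 isCont_pmf) auto
  ultimately show ?thesis by (subst isCont_cong)
qed

lemma differentiable_expectation_psi0:
  assumes "\<theta> \<in> \<Theta>"
  shows "(\<lambda>(\<theta>', t). measure_pmf.expectation (F \<theta>') (\<lambda>x. psi0 x t)) differentiable (at (\<theta>, \<theta>))"
proof (rule expectation_psi0_finite[OF assms])
  fix K assume ev: "\<forall>\<^sub>F t in nhds \<theta>. \<forall>\<theta>'\<in>\<Theta>. measure_pmf.expectation (F \<theta>') (\<lambda>x. psi0 x t) =
    (\<Sum>x\<in>{..K} \<inter> S. (pmf (F \<theta>') x - pmf (F t) x) * (psi0 x t - 1/2))"
  have "((\<lambda>z. (pmf (F (fst z)) x - pmf (F (snd z)) x) * (psi0 x (snd z) - 1/2)) has_derivative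
      (\<lambda>v. (pmf (F \<theta>) x * s x \<theta> * fst v - pmf (F \<theta>) x * s x \<theta> * snd v) * (psi0 x (snd (\<theta>, \<theta>)) - 1/2)))
      (at (\<theta>, \<theta>))" if "x \<in> S" for x
  proof (rule has_derivative_mult_vanishing)
    have D: "((\<lambda>t. pmf (F t) x) has_derivative (\<lambda>h. pmf (F \<theta>) x * s x \<theta> * h)) (at \<theta>)"
      using deriv_pmf[OF that assms] by (simp add: has_field_derivative_def)
    then have "((\<lambda>t. pmf (F t) x) has_derivative (\<lambda>h. pmf (F \<theta>) x * s x \<theta> * h)) (at (fst (\<theta>, \<theta>)))"
      "((\<lambda>t. pmf (F t) x) has_derivative (\<lambda>h. pmf (F \<theta>) x * s x \<theta> * h)) (at (snd (\<theta>, \<theta>)))"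
      by simp_all
    then show "((\<lambda>z. pmf (F (fst z)) x - pmf (F (snd z)) x) has_derivative
        (\<lambda>v. pmf (F \<theta>) x * s x \<theta> * fst v - pmf (F \<theta>) x * s x \<theta> * snd v)) (at (\<theta>, \<theta>))"
      by (intro has_derivative_diff has_derivative_compose[OF has_derivative_fst[OF has_derivative_ident]]
          has_derivative_compose[OF has_derivative_snd[OF has_derivative_ident]])
    show "isCont (\<lambda>z. psi0 x (snd z) - 1/2) (\<theta>, \<theta>)"
      using isCont_psi0[OF assms that] by (intro continuous_intros isCont_o2[where f = snd and g = "psi0 x"]) auto
  qed simp
  then have diff: "((\<lambda>z. \<Sum>x\<in>{..K} \<inter> S. (pmf (F (fst z)) x - pmf (F (snd z)) x) * (psi0 x (snd z) - 1/2))
      differentiable (at (\<theta>, \<theta>)))"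
    by (intro differentiable_sum) (auto simp: differentiable_def)
  have eq: "\<forall>\<^sub>F z in nhds (\<theta>, \<theta>). (\<Sum>x\<in>{..K} \<inter> S. (pmf (F (fst z)) x - pmf (F (snd z)) x) * (psi0 x (snd z) - 1/2)) =
      (case z of (\<theta>', t) \<Rightarrow> measure_pmf.expectation (F \<theta>') (\<lambda>x. psi0 x t))"
    using eventually_prodI[OF eventually_params[OF assms] ev] unfolding nhds_prod
    by (rule eventually_mono) (simp add: case_prod_unfold)
  obtain L where
    L: "((\<lambda>z. \<Sum>x\<in>{..K} \<inter> S. (pmf (F (fst z)) x - pmf (F (snd z)) x) * (psi0 x (snd z) - 1/2))
      has_derivative L) (at (\<theta>, \<theta>))"
    using diff unfolding differentiable_def by blast
  have "((\<lambda>(\<theta>', t). measure_pmf.expectation (F \<theta>') (\<lambda>x. psi0 x t)) has_derivative L) (at (\<theta>, \<theta>))"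
    by (rule has_derivative_transform_eventually[OF L])
      (use eq in \<open>simp_all add: eventually_nhds_conv_at\<close>)
  then show ?thesis by (auto simp: differentiable_def)
qed

section \<open>The domination in derivative form and its equality case\<close>

lemma derivative_bound:
  assumes \<theta>: "\<theta> \<in> \<Theta>" and M: "\<And>y. y \<in> S \<Longrightarrow> \<bar>\<psi> y\<bar> \<le> M"
    and E0: "measure_pmf.expectation (F \<theta>) \<psi> = 0"
    and l: "((\<lambda>t. measure_pmf.expectation (F t) \<psi>) has_real_derivative l) (at \<theta>)"
    and b: "((\<lambda>t. measure_pmf.expectation (F t) (\<lambda>y. psi0 y \<theta>)) has_real_derivative b) (at \<theta>)"
    and x: "x \<in> S"
  defines "k \<equiv> k0 (F \<theta>)"
  shows "pmf (F \<theta>) x * (\<sigma> * (s x \<theta> - s k \<theta>)) * (2 * M * psi0 x \<theta> - \<psi> x) \<le> \<sigma> * (2 * M * b - l)"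
    and "0 \<le> \<sigma> * (2 * M * b - l)"
proof -
  have k: "k \<in> S" using \<theta> by (simp add: k_def k0_in)
  have pk: "pmf (F \<theta>) k > 0" using \<theta> k by (rule pmf_pos)
  define d where "d = 2 * M * psi0 x \<theta> - \<psi> x"
  \<comment> \<open>\<open>L\<close> is a single term of the dominating series and \<open>R\<close>
    its bound. Both vanish at \<open>\<theta>\<close> and \<open>0 \<le> L \<le> R\<close> on the
    \<open>\<sigma>\<close> side, so the slopes of \<open>R\<close> and \<open>R - L\<close> have a
    sign. Differentiating \<open>L\<close> involves only the masses at \<open>x\<close> and
    \<open>k\<close>.\<close>
  define R where "R t = pmf (F \<theta>) k * (2 * M * measure_pmf.expectation (F t) (\<lambda>y. psi0 y \<theta>)
          - measure_pmf.expectation (F t) \<psi>)" for t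
  define L where "L t = (pmf (F t) x * pmf (F \<theta>) k - pmf (F t) k * pmf (F \<theta>) x) * d" for t
  have R0: "R \<theta> = 0" by (simp add: R_def E0 expectation_psi0)
  have R': "(R has_real_derivative pmf (F \<theta>) k * (2 * M * b - l)) (at \<theta>)"
    unfolding R_def by (intro DERIV_cmult DERIV_diff l b)
  have L': "(L has_real_derivative (pmf (F \<theta>) x * s x \<theta> * pmf (F \<theta>) k
      - pmf (F \<theta>) k * s k \<theta> * pmf (F \<theta>) x) * d) (at \<theta>)"
    unfolding L_def by (intro DERIV_cmult_right DERIV_diff deriv_pmf x k \<theta>)
  have LR: "\<forall>\<^sub>F t in nhds \<theta>. \<sigma> * \<theta> < \<sigma> * t \<longrightarrow> 0 \<le> L t \<and> L t \<le> R t"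
    using eventually_params[OF \<theta>]
    by eventually_elim
      (use dominated_by_psi0[OF \<theta> M E0 _ _ x] in \<open>auto simp: L_def R_def d_def k_def\<close>)
  have "0 \<le> \<sigma> * (pmf (F \<theta>) k * (2 * M * b - l))"
    by (rule DERIV_nonneg_one_sided[OF R' R0 sigma], use LR in eventually_elim) auto
  then have "0 \<le> pmf (F \<theta>) k * (\<sigma> * (2 * M * b - l))" by (simp add: mult_ac)
  then show "0 \<le> \<sigma> * (2 * M * b - l)" using pk by (simp add: zero_le_mult_iff)
  have "0 \<le> \<sigma> * (pmf (F \<theta>) k * (2 * M * b - l) -
      (pmf (F \<theta>) x * s x \<theta> * pmf (F \<theta>) k - pmf (F \<theta>) k * s k \<theta> * pmf (F \<theta>) x) * d)"
    by (rule DERIV_nonneg_one_sided[OF DERIV_diff[OF R' L'] _ sigma], simp add: R0 L_def,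
        use LR in eventually_elim) auto
  also have "\<dots> = pmf (F \<theta>) k * (\<sigma> * (2 * M * b - l) - pmf (F \<theta>) x * (\<sigma> * (s x \<theta> - s k \<theta>)) * d)"
    by (simp add: algebra_simps)
  finally show "pmf (F \<theta>) x * (\<sigma> * (s x \<theta> - s k \<theta>)) * (2 * M * psi0 x \<theta> - \<psi> x) \<le> \<sigma> * (2 * M * b - l)"
    using pk by (simp add: zero_le_mult_iff d_def)
qed

lemma score_sign:
  assumes "\<theta> \<in> \<Theta>" "x \<in> S" "k \<in> S"
  shows "x < k \<Longrightarrow> \<sigma> * (s x \<theta> - s k \<theta>) < 0" "k < x \<Longrightarrow> \<sigma> * (s x \<theta> - s k \<theta>) > 0"
  using score_mono[of \<theta> x k] score_mono[of \<theta> k x] assms by (auto simp: algebra_simps)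

text \<open>The bound for \<open>\<psi> = 0\<close> and \<open>M = 1/2\<close> compares
  \<open>\<sigma> * b\<close> with a single term, which is positive at any
  \<open>x \<noteq> k\<close>.\<close>

lemma derivative_psi0_pos:
  assumes \<theta>: "\<theta> \<in> \<Theta>"
    and b: "((\<lambda>t. measure_pmf.expectation (F t) (\<lambda>y. psi0 y \<theta>)) has_real_derivative b) (at \<theta>)"
  shows "\<sigma> * b > 0"
proof -
  define k where "k = k0 (F \<theta>)"
  have k: "k \<in> S" using \<theta> by (simp add: k_def k0_in)
  obtain x where x: "x \<in> S" "x \<noteq> k" using two_points by blast
  have "(\<sigma> * (s x \<theta> - s k \<theta>)) * psi0 x \<theta> > 0"
    using score_sign[OF \<theta> x(1) k] x(2) psi0_side[where x = x and t = \<theta>]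
    by (cases "x < k") (auto simp: k_def mult_neg_neg)
  then have "0 < pmf (F \<theta>) x * (\<sigma> * (s x \<theta> - s k \<theta>) * psi0 x \<theta>)"
    by (rule mult_pos_pos[OF pmf_pos[OF \<theta> x(1)]])
  then show ?thesis
    using derivative_bound(1)[OF \<theta> _ _ _ b x(1), of "\<lambda>_. 0" "1/2" 0] by (simp add: k_def mult.assoc)
qed

text \<open>With equality, the derivative bound pushes \<open>2 * M * psi0 - \<psi>\<close> to one
  side of 0 off \<open>k\<close>, while \<open>\<bar>\<psi>\<bar> \<le> M\<close> pushes it to the
  other. The value at \<open>k\<close> is then fixed by mean zero.\<close>

lemma extremal_psi:
  assumes \<theta>: "\<theta> \<in> \<Theta>" and M: "\<And>y. y \<in> S \<Longrightarrow> \<bar>\<psi> y\<bar> \<le> M"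
    and E0: "measure_pmf.expectation (F \<theta>) \<psi> = 0"
    and l: "((\<lambda>t. measure_pmf.expectation (F t) \<psi>) has_real_derivative l) (at \<theta>)"
    and b: "((\<lambda>t. measure_pmf.expectation (F t) (\<lambda>y. psi0 y \<theta>)) has_real_derivative b) (at \<theta>)"
    and eq: "l = 2 * M * b"
    and x: "x \<in> S"
  shows "\<psi> x = 2 * M * psi0 x \<theta>"
proof -
  define k where "k = k0 (F \<theta>)"
  have k: "k \<in> S" using \<theta> by (simp add: k_def k0_in)
  have off: "\<psi> y = 2 * M * psi0 y \<theta>" if y: "y \<in> S" "y \<noteq> k" for y
  proof -
    have le: "pmf (F \<theta>) y * (\<sigma> * (s y \<theta> - s k \<theta>)) * (2 * M * psi0 y \<theta> - \<psi> y) \<le> 0"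
      using derivative_bound(1)[OF \<theta> M E0 l b y(1)] eq by (simp add: k_def)
    have p: "pmf (F \<theta>) y > 0" using \<theta> y(1) by (rule pmf_pos)
    show ?thesis
    proof (cases "y < k")
      case True
      then have "pmf (F \<theta>) y * (\<sigma> * (s y \<theta> - s k \<theta>)) < 0"
        using score_sign(1)[OF \<theta> y(1) k] p by (simp add: mult_pos_neg)
      with le have "2 * M * psi0 y \<theta> - \<psi> y \<ge> 0" by (metis mult_neg_neg not_le)
      then show ?thesis using psi0_side(1)[of y \<theta>] True M[OF y(1)] by (simp add: k_def)
    next
      case False
      then have "k < y" using y(2) by simp
      then have "pmf (F \<theta>) y * (\<sigma> * (s y \<theta> - s k \<theta>)) > 0"
        using score_sign(2)[OF \<theta> y(1) k] p by simp
      with le have "2 * M * psi0 y \<theta> - \<psi> y \<le> 0" by (metis mult_pos_pos not_le)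
      moreover have half: "psi0 y \<theta> = 1/2" using psi0_side(2) \<open>k < y\<close> unfolding k_def .
      ultimately show ?thesis using M[OF y(1)] unfolding half by simp
    qed
  qed
  have int: "integrable (measure_pmf (F \<theta>)) \<psi>"
    using M \<theta> by (intro integrable_bounded_pmf[of _ _ M]) (simp add: support)
  have "measure_pmf.expectation (F \<theta>) (\<lambda>y. \<psi> y - 2 * M * psi0 y \<theta>) = 0"
    using int E0 by (simp add: integrable_psi0 expectation_psi0)
  moreover have "measure_pmf.expectation (F \<theta>) (\<lambda>y. \<psi> y - 2 * M * psi0 y \<theta>) =
      (\<psi> k - 2 * M * psi0 k \<theta>) * pmf (F \<theta>) k"
    using off \<theta> by (subst integral_measure_pmf_real[of "{k}"]) (auto simp: support)
  ultimately have "\<psi> k = 2 * M * psi0 k \<theta>" using pmf_pos[OF \<theta> k] by simp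
  then show ?thesis using off x by (cases "x = k") auto
qed

subsection \<open>Influence functions\<close>

lemma contaminate_0: "contaminate 0 x G = G"
  by (rule pmf_eqI) (simp add: pmf_contaminate)

text \<open>Identifies the influence function as \<open>\<psi> / l\<close>: the estimating equation
  at the contaminated distribution is divided by \<open>\<epsilon>\<close> and passed to the limit.
  If \<open>l\<close> were 0, \<open>\<psi>\<close> would vanish on \<open>S\<close>, against
  nondegeneracy.\<close>

lemma M_estimator_derivs:
  assumes T: "Fisher_consistent_M_estimator F \<Theta> S \<psi> D T" and \<theta>: "\<theta> \<in> \<Theta>"
  obtains l where "l \<noteq> 0"
    "((\<lambda>t. measure_pmf.expectation (F t) (\<lambda>x. \<psi> x \<theta>)) has_real_derivative l) (at \<theta>)"
    "\<And>x. x \<in> S \<Longrightarrow> l * influence T (F \<theta>) x = \<psi> x \<theta>"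
proof -
  have cons: "F t \<in> D" "T (F t) = t" if "t \<in> \<Theta>" for t
    using T that by (auto simp: Fisher_consistent_M_estimator_def Fisher_consistent_def)
  have Meq: "M_equation \<psi> G (T G)" if "G \<in> D" for G
    using T that by (auto simp: Fisher_consistent_M_estimator_def M_estimator_def)
  have E0: "measure_pmf.expectation (F t) (\<lambda>x. \<psi> x t) = 0" if "t \<in> \<Theta>" for t
    using Meq[OF cons(1)[OF that]] cons(2)[OF that] by (simp add: M_equation_def)
  have cont: "\<And>x. x \<in> S \<Longrightarrow> isCont (\<psi> x) \<theta>" and nz: "\<exists>x\<in>S. \<psi> x \<theta> \<noteq> 0"
    and int: "\<forall>\<^sub>F (\<theta>', t) in nhds (\<theta>, \<theta>). integrable (measure_pmf (F \<theta>')) (\<lambda>x. \<psi> x t)"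
    and diff: "(\<lambda>(\<theta>', t). measure_pmf.expectation (F \<theta>') (\<lambda>x. \<psi> x t)) differentiable (at (\<theta>, \<theta>))"
    using T \<theta> by (auto simp: Fisher_consistent_M_estimator_def regular_psi_def)
  obtain l where l: "((\<lambda>t. measure_pmf.expectation (F t) (\<lambda>x. \<psi> x \<theta>)) has_real_derivative l) (at \<theta>)"
    "((\<lambda>t. measure_pmf.expectation (F \<theta>) (\<lambda>x. \<psi> x t)) has_real_derivative - l) (at \<theta>)"
    by (rule partial_derivs_opposite[OF diff eventually_mono[OF eventually_params[OF \<theta>] E0]])
  \<comment> \<open>The Caratheodory slope \<open>g\<close> replaces the difference quotient in
    \<open>t\<close>, which is undefined when the contaminated estimate equals
    \<open>\<theta>\<close>.\<close>
  obtain g where g: "\<And>z. measure_pmf.expectation (F \<theta>) (\<lambda>x. \<psi> x z) = g z * (z - \<theta>)" "isCont g \<theta>" "g \<theta> = - l"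
    using l(2) E0[OF \<theta>] unfolding CARAT_DERIV by auto
  have infl: "l * influence T (F \<theta>) x = \<psi> x \<theta>" if x: "x \<in> S" for x
  proof -
    define \<tau> where "\<tau> \<epsilon> = T (contaminate \<epsilon> x (F \<theta>))" for \<epsilon>
    define I where "I = influence T (F \<theta>) x"
    have hi: "has_influence D T (F \<theta>) x"
      using T \<theta> x by (auto simp: Fisher_consistent_M_estimator_def)
    have \<tau>0: "\<tau> 0 = \<theta>" by (simp add: \<tau>_def contaminate_0 cons \<theta>)
    have "(\<tau> has_vector_derivative I) (at 0 within {0..1})"
      using hi unfolding has_influence_def I_def influence_def \<tau>_def
      by (simp add: vector_derivative_works)
    then have d: "(\<tau> has_real_derivative I) (at 0 within {0..1})"
      by (simp add: has_real_derivative_iff_has_vector_derivative)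
    have right: "at 0 within {0..1::real} = at_right 0" by (simp add: at_within_Icc_at_right)
    have quot: "((\<lambda>\<epsilon>. (\<tau> \<epsilon> - \<theta>) / \<epsilon>) \<longlongrightarrow> I) (at_right 0)"
      using d \<tau>0 by (simp add: has_field_derivative_iff right)
    have lim: "(\<tau> \<longlongrightarrow> \<theta>) (at_right 0)"
      using DERIV_continuous[OF d] by (simp add: continuous_within right \<tau>0)
    have "filterlim (\<lambda>\<epsilon>. (\<theta>, \<tau> \<epsilon>)) (nhds (\<theta>, \<theta>)) (at_right 0)"
      using lim by (intro tendsto_Pair tendsto_const)
    then have ev1: "\<forall>\<^sub>F \<epsilon> in at_right 0. integrable (measure_pmf (F \<theta>)) (\<lambda>x. \<psi> x (\<tau> \<epsilon>))"
      using int by (auto simp: filterlim_iff dest: spec)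
    have ev2: "\<forall>\<^sub>F \<epsilon> in at_right 0. contaminate \<epsilon> x (F \<theta>) \<in> D"
      using hi by (simp add: has_influence_def)
    have ev3: "\<forall>\<^sub>F \<epsilon> in at_right 0. \<epsilon> \<in> {0<..<1::real}"
      by (rule eventually_at_right_real) simp
    have "\<forall>\<^sub>F \<epsilon> in at_right 0. (1 - \<epsilon>) * g (\<tau> \<epsilon>) * ((\<tau> \<epsilon> - \<theta>) / \<epsilon>) + \<psi> x (\<tau> \<epsilon>) = 0"
      using ev1 ev2 ev3
    proof eventually_elim
      case (elim \<epsilon>)
      have "M_equation \<psi> (contaminate \<epsilon> x (F \<theta>)) (\<tau> \<epsilon>)"
        unfolding \<tau>_def by (rule Meq) (rule elim)
      then have "(1 - \<epsilon>) * (g (\<tau> \<epsilon>) * (\<tau> \<epsilon> - \<theta>)) + \<epsilon> * \<psi> x (\<tau> \<epsilon>) = 0"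
        using elim expectation_contaminate[of \<epsilon> "F \<theta>" "\<lambda>x. \<psi> x (\<tau> \<epsilon>)" x]
        by (simp add: M_equation_def g(1))
      then show ?case using elim by (simp add: field_simps)
    qed
    then have "((\<lambda>\<epsilon>. (1 - \<epsilon>) * g (\<tau> \<epsilon>) * ((\<tau> \<epsilon> - \<theta>) / \<epsilon>) + \<psi> x (\<tau> \<epsilon>)) \<longlongrightarrow> 0) (at_right 0)"
      by (rule tendsto_eventually)
    moreover have "((\<lambda>\<epsilon>. (1 - \<epsilon>) * g (\<tau> \<epsilon>) * ((\<tau> \<epsilon> - \<theta>) / \<epsilon>) + \<psi> x (\<tau> \<epsilon>)) \<longlongrightarrow> (1 - 0) * g \<theta> * I + \<psi> x \<theta>) (at_right 0)"
      by (intro tendsto_intros quot isCont_tendsto_compose[OF g(2) lim]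
          isCont_tendsto_compose[OF cont[OF x] lim])
    ultimately have "(1 - 0) * g \<theta> * I + \<psi> x \<theta> = 0"
      by (intro tendsto_unique[of "at_right (0::real)"]) auto
    then show ?thesis by (simp add: g(3) I_def)
  qed
  moreover have "l \<noteq> 0" using infl nz by auto
  ultimately show thesis using l(1) that by blast
qed

section \<open>Existence and differentiability of the uniform median estimator near the
  model\<close>

lemma expectation_psi0_eq_0_iff:
  assumes "t \<in> \<Theta>" "set_pmf G = S"
  shows "measure_pmf.expectation G (\<lambda>x. psi0 x t) = 0 \<longleftrightarrow> umed G = umed (F t)"
proof
  assume "measure_pmf.expectation G (\<lambda>x. psi0 x t) = 0"
  then show "umed G = umed (F t)"
    using assms by (intro umed_eq_of_expectation_huber) (auto simp: psi0_conv support set_pmf_iff)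
next
  assume "umed G = umed (F t)"
  then show "measure_pmf.expectation G (\<lambda>x. psi0 x t) = 0"
    using expectation_huber_umed[of G] by (simp add: psi0_conv)
qed

text \<open>By strict monotonicity \<open>\<sigma> * f\<close> is positive at
  \<open>\<theta> - d\<close> and negative at \<open>\<theta> + d\<close>, and a small contamination
  keeps these signs. A zero in between, from the intermediate value theorem, solves the median
  equation.\<close>

lemma eventually_umed_est_contaminate:
  assumes \<theta>: "\<theta> \<in> \<Theta>" and x: "x \<in> S" and \<delta>: "\<delta> > 0"
  shows "\<forall>\<^sub>F \<epsilon> in at_right 0. contaminate \<epsilon> x (F \<theta>) \<in> umed_dom F \<Theta> \<and>
    \<bar>umed_est F \<Theta> (contaminate \<epsilon> x (F \<theta>)) - \<theta>\<bar> \<le> \<delta> \<and>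
    umed_est F \<Theta> (contaminate \<epsilon> x (F \<theta>)) \<in> \<Theta> \<and>
    umed (contaminate \<epsilon> x (F \<theta>)) = umed (F (umed_est F \<Theta> (contaminate \<epsilon> x (F \<theta>))))"
proof -
  obtain e where e: "e > 0" "cball \<theta> e \<subseteq> \<Theta>"
    using open_params \<theta> open_contains_cball by blast
  define d where "d = min \<delta> e"
  have d: "d > 0" "d \<le> \<delta>" "{\<theta> - d..\<theta> + d} \<subseteq> \<Theta>"
    using \<delta> e by (auto simp: d_def cball_eq_atLeastAtMost min_def)
  define f where "f t = measure_pmf.expectation (F \<theta>) (\<lambda>y. psi0 y t)" for t
  have ends: "\<theta> - d \<in> \<Theta>" "\<theta> + d \<in> \<Theta>" using d by auto
  have f1: "\<sigma> * f (\<theta> - d) > 0" and f2: "\<sigma> * f (\<theta> + d) < 0"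
    using sigma expectation_psi0_sign[OF ends(1) \<theta>] expectation_psi0_sign[OF \<theta> ends(1)]
      expectation_psi0_sign[OF ends(2) \<theta>] expectation_psi0_sign[OF \<theta> ends(2)] d(1)
    by (auto simp: f_def)
  define \<Phi> where "\<Phi> \<epsilon> t = \<sigma> * ((1 - \<epsilon>) * f t + \<epsilon> * psi0 x t)" for \<epsilon> t
  have lim: "((\<lambda>\<epsilon>. \<Phi> \<epsilon> t) \<longlongrightarrow> \<sigma> * ((1 - 0) * f t + 0 * psi0 x t)) (at_right 0)" for t
    unfolding \<Phi>_def by (intro tendsto_intros)
  have "\<forall>\<^sub>F \<epsilon> in at_right 0. \<Phi> \<epsilon> (\<theta> - d) > 0"
    by (rule order_tendstoD(1)[OF lim]) (use f1 in simp)
  moreover have "\<forall>\<^sub>F \<epsilon> in at_right 0. \<Phi> \<epsilon> (\<theta> + d) < 0"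
    by (rule order_tendstoD(2)[OF lim]) (use f2 in simp)
  moreover have "\<forall>\<^sub>F \<epsilon> in at_right 0. \<epsilon> \<in> {0<..<1::real}"
    by (rule eventually_at_right_real) simp
  ultimately show ?thesis
  proof eventually_elim
    case (elim \<epsilon>)
    have "continuous_on {\<theta> - d..\<theta> + d} (\<Phi> \<epsilon>)"
      unfolding \<Phi>_def f_def using d(3) x \<theta>
      by (intro continuous_at_imp_continuous_on ballI continuous_intros isCont_psi0 isCont_expectation_psi0) auto
    then obtain t where t: "\<theta> - d \<le> t" "t \<le> \<theta> + d" "\<Phi> \<epsilon> t = 0"
      using IVT2'[of "\<Phi> \<epsilon>" "\<theta> + d" 0 "\<theta> - d"] elim d(1) by auto
    have t\<Theta>: "t \<in> \<Theta>" using t d(3) by auto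
    have "measure_pmf.expectation (contaminate \<epsilon> x (F \<theta>)) (\<lambda>y. psi0 y t) = 0"
      using t(3) elim sigma
        expectation_contaminate[of \<epsilon> "F \<theta>" "\<lambda>y. psi0 y t" x, OF _ _ integrable_psi0 integrable_psi0]
      by (auto simp: \<Phi>_def f_def)
    then have "umed (contaminate \<epsilon> x (F \<theta>)) = umed (F t)"
      using elim x \<theta> t\<Theta> by (subst (asm) expectation_psi0_eq_0_iff) (auto simp: set_pmf_contaminate support)
    then show ?case using t d t\<Theta> umed_est_eq[OF t\<Theta>, of "contaminate \<epsilon> x (F \<theta>)"]
      by (auto simp: umed_dom_def abs_le_iff)
  qed
qed

text \<open>Solving the contaminated equation for the difference quotient gives \<open>- psi0 x
  (\<tau> \<epsilon>) / ((1 - \<epsilon>) * g (\<tau> \<epsilon>))\<close>. Its limit exists because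
  \<open>\<tau> \<epsilon>\<close> tends to \<open>\<theta>\<close>, \<open>psi0 x\<close> is
  continuous and \<open>b \<noteq> 0\<close>.\<close>

lemma has_influence_umed_est:
  assumes \<theta>: "\<theta> \<in> \<Theta>" and x: "x \<in> S"
  shows "has_influence (umed_dom F \<Theta>) (umed_est F \<Theta>) (F \<theta>) x"
proof -
  define \<tau> where "\<tau> \<epsilon> = umed_est F \<Theta> (contaminate \<epsilon> x (F \<theta>))" for \<epsilon>
  define f where "f t = measure_pmf.expectation (F \<theta>) (\<lambda>y. psi0 y t)" for t
  have \<tau>0: "\<tau> 0 = \<theta>" by (simp add: \<tau>_def contaminate_0 umed_est_eq \<theta>)
  have right: "at 0 within {0..1::real} = at_right 0" by (simp add: at_within_Icc_at_right)
  obtain b where b: "((\<lambda>t. measure_pmf.expectation (F t) (\<lambda>y. psi0 y \<theta>)) has_real_derivative b) (at \<theta>)"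
    "(f has_real_derivative - b) (at \<theta>)"
    unfolding f_def
    by (rule partial_derivs_opposite[OF differentiable_expectation_psi0[OF \<theta>]])
      (simp_all add: expectation_psi0)
  have "b \<noteq> 0" using derivative_psi0_pos[OF \<theta> b(1)] by auto
  obtain g where g: "\<And>z. f z = g z * (z - \<theta>)" "isCont g \<theta>" "g \<theta> = - b"
    using b(2) expectation_psi0[of \<theta>] unfolding CARAT_DERIV by (auto simp: f_def)
  note ev = eventually_umed_est_contaminate[OF \<theta> x, folded \<tau>_def]
  have lim: "(\<tau> \<longlongrightarrow> \<theta>) (at_right 0)"
    unfolding tendsto_iff
  proof (intro allI impI)
    fix e :: real assume "e > 0"
    then have "\<forall>\<^sub>F \<epsilon> in at_right 0. \<bar>\<tau> \<epsilon> - \<theta>\<bar> \<le> e / 2"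
      using ev[of "e / 2"] by (auto elim: eventually_mono)
    then show "\<forall>\<^sub>F \<epsilon> in at_right 0. dist (\<tau> \<epsilon>) \<theta> < e"
      by eventually_elim (use \<open>e > 0\<close> in \<open>simp add: dist_real_def\<close>)
  qed
  have glim: "((\<lambda>\<epsilon>. g (\<tau> \<epsilon>)) \<longlongrightarrow> - b) (at_right 0)"
    using isCont_tendsto_compose[OF g(2) lim] by (simp add: g(3))
  have "((\<lambda>\<epsilon>. - psi0 x (\<tau> \<epsilon>) / ((1 - \<epsilon>) * g (\<tau> \<epsilon>))) \<longlongrightarrow> - psi0 x \<theta> / ((1 - 0) * - b)) (at_right 0)"
    using \<open>b \<noteq> 0\<close>
    by (intro tendsto_intros glim isCont_tendsto_compose[OF isCont_psi0[OF \<theta> x] lim]) auto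
  moreover have "\<forall>\<^sub>F \<epsilon> in at_right 0. - psi0 x (\<tau> \<epsilon>) / ((1 - \<epsilon>) * g (\<tau> \<epsilon>)) = (\<tau> \<epsilon> - \<tau> 0) / (\<epsilon> - 0)"
  proof -
    have "\<forall>\<^sub>F \<epsilon> in at_right 0. g (\<tau> \<epsilon>) \<noteq> 0"
      by (rule tendsto_imp_eventually_ne[OF glim]) (use \<open>b \<noteq> 0\<close> in simp)
    moreover have "\<forall>\<^sub>F \<epsilon> in at_right 0. \<epsilon> \<in> {0<..<1::real}"
      by (rule eventually_at_right_real) simp
    ultimately show ?thesis using ev[OF zero_less_one]
    proof eventually_elim
      case (elim \<epsilon>)
      have "measure_pmf.expectation (contaminate \<epsilon> x (F \<theta>)) (\<lambda>y. psi0 y (\<tau> \<epsilon>)) = 0"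
        using elim x \<theta> by (subst expectation_psi0_eq_0_iff) (auto simp: set_pmf_contaminate support)
      then have "(1 - \<epsilon>) * (g (\<tau> \<epsilon>) * (\<tau> \<epsilon> - \<theta>)) + \<epsilon> * psi0 x (\<tau> \<epsilon>) = 0"
        using elim expectation_contaminate[of \<epsilon> "F \<theta>" "\<lambda>y. psi0 y (\<tau> \<epsilon>)" x, OF _ _ integrable_psi0 integrable_psi0]
        by (simp add: g(1)[symmetric] f_def)
      then have "- psi0 x (\<tau> \<epsilon>) * \<epsilon> = (\<tau> \<epsilon> - \<theta>) * ((1 - \<epsilon>) * g (\<tau> \<epsilon>))"
        by (simp add: algebra_simps)
      moreover have "(1 - \<epsilon>) * g (\<tau> \<epsilon>) \<noteq> 0" "\<epsilon> \<noteq> 0" using elim by auto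
      ultimately show ?case by (simp only: \<tau>0 diff_zero frac_eq_eq not_False_eq_True)
    qed
  qed
  ultimately have "((\<lambda>\<epsilon>. (\<tau> \<epsilon> - \<tau> 0) / (\<epsilon> - 0)) \<longlongrightarrow> - psi0 x \<theta> / ((1 - 0) * - b)) (at_right 0)"
    by (rule Lim_transform_eventually)
  then have "(\<tau> has_real_derivative - psi0 x \<theta> / ((1 - 0) * - b)) (at 0 within {0..1})"
    by (simp only: has_field_derivative_iff right)
  then have "\<tau> differentiable (at 0 within {0..1})"
    unfolding real_differentiable_def by blast
  moreover have "\<forall>\<^sub>F \<epsilon> in at_right 0. contaminate \<epsilon> x (F \<theta>) \<in> umed_dom F \<Theta>"
    using ev[OF zero_less_one] by (auto elim: eventually_mono)
  ultimately show ?thesis by (simp add: has_influence_def \<tau>_def[abs_def])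
qed

lemma M_equation_psi0:
  assumes "umed G = umed (F t)"
  shows "M_equation psi0 G t"
  using expectation_huber_umed[of G] assms
  by (simp add: M_equation_def integrable_psi0) (simp add: psi0_conv)

lemma umed_est_competitor:
  "Fisher_consistent_M_estimator F \<Theta> S psi0 (umed_dom F \<Theta>) (umed_est F \<Theta>)"
  unfolding Fisher_consistent_M_estimator_def
proof (intro conjI ballI)
  show "M_estimator \<Theta> psi0 (umed_dom F \<Theta>) (umed_est F \<Theta>)"
    by (auto simp: M_estimator_def umed_dom_def umed_est_eq M_equation_psi0)
  show "Fisher_consistent F \<Theta> (umed_dom F \<Theta>) (umed_est F \<Theta>)"
    by (auto simp: Fisher_consistent_def umed_dom_def umed_est_eq)
  have "\<exists>x\<in>S. psi0 x \<theta> \<noteq> 0" for \<theta>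
  proof -
    obtain x where x: "x \<in> S" "x \<noteq> k0 (F \<theta>)" using two_points by blast
    then have "psi0 x \<theta> \<noteq> 0"
      using psi0_side[where x = x and t = \<theta>] by (cases "x < k0 (F \<theta>)") auto
    with x show ?thesis by blast
  qed
  then show "regular_psi F \<Theta> S psi0"
    unfolding regular_psi_def
    by (intro ballI conjI isCont_psi0 differentiable_expectation_psi0)
      (simp_all add: integrable_psi0 case_prod_unfold)
qed (rule has_influence_umed_est)

section \<open>Upper and lower bounds for the gross-error sensitivity\<close>

lemma GES_umed_est_le:
  assumes \<theta>: "\<theta> \<in> \<Theta>"
    and b: "((\<lambda>t. measure_pmf.expectation (F t) (\<lambda>y. psi0 y \<theta>)) has_real_derivative b) (at \<theta>)"
  shows "GES S (umed_est F \<Theta>) (F \<theta>) \<le> ereal (1 / (2 * \<bar>b\<bar>))"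
proof -
  obtain l where l: "l \<noteq> 0"
    "((\<lambda>t. measure_pmf.expectation (F t) (\<lambda>x. psi0 x \<theta>)) has_real_derivative l) (at \<theta>)"
    "\<And>x. x \<in> S \<Longrightarrow> l * influence (umed_est F \<Theta>) (F \<theta>) x = psi0 x \<theta>"
    using M_estimator_derivs[OF umed_est_competitor \<theta>] by blast
  have "l = b" using l(2) b by (rule DERIV_unique)
  show ?thesis unfolding GES_def
  proof (rule SUP_least)
    fix x assume "x \<in> S"
    then have "\<bar>b\<bar> * \<bar>influence (umed_est F \<Theta>) (F \<theta>) x\<bar> \<le> 1/2"
      using l(3)[of x] \<open>l = b\<close> abs_psi0_le[of x \<theta>] by (metis abs_mult)
    then show "ereal \<bar>influence (umed_est F \<Theta>) (F \<theta>) x\<bar> \<le> ereal (1 / (2 * \<bar>b\<bar>))"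
      using l(1) \<open>l = b\<close> by (simp add: field_simps)
  qed
qed

text \<open>Since \<open>\<psi>\<close> is \<open>l\<close> times the influence function, a bound
  \<open>g\<close> on the GES yields \<open>\<bar>\<psi>\<bar> \<le> M\<close> with
  \<open>M = \<bar>l\<bar> * g\<close>. The derivative bound for \<open>\<psi>\<close> and for
  \<open>- \<psi>\<close> gives \<open>\<bar>l\<bar> \<le> 2 * M * \<bar>b\<bar>\<close>, and
  \<open>\<bar>l\<bar>\<close> cancels.\<close>

lemma optimal_psi:
  assumes T: "Fisher_consistent_M_estimator F \<Theta> S \<psi> D T" and \<theta>: "\<theta> \<in> \<Theta>"
    and b: "((\<lambda>t. measure_pmf.expectation (F t) (\<lambda>y. psi0 y \<theta>)) has_real_derivative b) (at \<theta>)"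
  shows "ereal (1 / (2 * \<bar>b\<bar>)) \<le> GES S T (F \<theta>)"
    and "GES S T (F \<theta>) \<le> ereal (1 / (2 * \<bar>b\<bar>)) \<Longrightarrow> \<exists>c. c \<noteq> 0 \<and> (\<forall>x\<in>S. \<psi> x \<theta> = c * psi0 x \<theta>)"
proof -
  obtain l where l: "l \<noteq> 0"
    "((\<lambda>t. measure_pmf.expectation (F t) (\<lambda>x. \<psi> x \<theta>)) has_real_derivative l) (at \<theta>)"
    "\<And>x. x \<in> S \<Longrightarrow> l * influence T (F \<theta>) x = \<psi> x \<theta>"
    using M_estimator_derivs[OF T \<theta>] by blast
  have E0: "measure_pmf.expectation (F \<theta>) (\<lambda>x. \<psi> x \<theta>) = 0"
    using T \<theta> unfolding Fisher_consistent_M_estimator_def Fisher_consistent_def M_estimator_def M_equation_def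
    by metis
  have b0: "\<sigma> * b > 0" using derivative_psi0_pos[OF \<theta> b] .
  have sb: "\<bar>b\<bar> = \<sigma> * b" using b0 sigma by auto
  have bound: "\<bar>\<psi> x \<theta>\<bar> \<le> \<bar>l\<bar> * g" if "GES S T (F \<theta>) \<le> ereal g" "x \<in> S" for g x
  proof -
    have "ereal \<bar>influence T (F \<theta>) x\<bar> \<le> GES S T (F \<theta>)"
      unfolding GES_def using that(2) by (rule SUP_upper)
    then have "\<bar>influence T (F \<theta>) x\<bar> \<le> g" using that(1) order_trans by fastforce
    then show ?thesis using l(3)[OF that(2)] by (metis abs_mult abs_ge_zero mult_left_mono)
  qed
  have l': "((\<lambda>t. measure_pmf.expectation (F t) (\<lambda>x. - \<psi> x \<theta>)) has_real_derivative - l) (at \<theta>)"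
    using DERIV_minus[OF l(2)] by simp
  \<comment> \<open>Stated for an arbitrary real upper bound \<open>g\<close>, since the GES itself
    may be infinite.\<close>
  have lower: "1 / (2 * \<bar>b\<bar>) \<le> g" if g: "GES S T (F \<theta>) \<le> ereal g" for g
  proof -
    obtain x where x: "x \<in> S" using two_points by blast
    have "0 \<le> \<sigma> * (2 * (\<bar>l\<bar> * g) * b - l)"
      using derivative_bound(2)[OF \<theta> bound[OF g] E0 l(2) b x] .
    moreover have "0 \<le> \<sigma> * (2 * (\<bar>l\<bar> * g) * b - - l)"
      by (rule derivative_bound(2)[OF \<theta> _ _ l' b x]) (use bound[OF g] E0 in auto)
    moreover have "\<sigma> * (2 * (\<bar>l\<bar> * g) * b - l) = \<bar>l\<bar> * (2 * g * \<bar>b\<bar>) - \<sigma> * l"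
      "\<sigma> * (2 * (\<bar>l\<bar> * g) * b - - l) = \<bar>l\<bar> * (2 * g * \<bar>b\<bar>) + \<sigma> * l"
      unfolding sb by (simp_all add: algebra_simps)
    moreover have "\<bar>l\<bar> = \<bar>\<sigma> * l\<bar>" using sigma by auto
    ultimately have "\<bar>l\<bar> \<le> \<bar>l\<bar> * (2 * g * \<bar>b\<bar>)" by linarith
    then have "1 \<le> 2 * g * \<bar>b\<bar>" using l(1) by simp
    then show ?thesis using b0 sb by (simp add: field_simps)
  qed
  show "ereal (1 / (2 * \<bar>b\<bar>)) \<le> GES S T (F \<theta>)"
  proof (cases "GES S T (F \<theta>)")
    case (real r)
    then show ?thesis using lower[of r] by simp
  next
    case MInf
    then show ?thesis using lower[of "1 / (2 * \<bar>b\<bar>) - 1"] by simp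
  qed simp
  assume opt: "GES S T (F \<theta>) \<le> ereal (1 / (2 * \<bar>b\<bar>))"
  define M where "M = \<bar>l\<bar> * (1 / (2 * \<bar>b\<bar>))"
  have M: "\<bar>\<psi> x \<theta>\<bar> \<le> M" if "x \<in> S" for x
    unfolding M_def by (rule bound[OF opt that])
  have "b \<noteq> 0" using b0 by auto
  then have "M > 0" using l(1) unfolding M_def by (intro mult_pos_pos divide_pos_pos) auto
  \<comment> \<open>At the optimal value equality holds up to sign, and the extremal case applies to
    \<open>\<psi>\<close> or to \<open>- \<psi>\<close> accordingly.\<close>
  have Mb: "2 * M * b = l \<or> 2 * M * b = - l" using \<open>b \<noteq> 0\<close> by (auto simp: M_def abs_if)
  then show "\<exists>c. c \<noteq> 0 \<and> (\<forall>x\<in>S. \<psi> x \<theta> = c * psi0 x \<theta>)"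
  proof
    assume "2 * M * b = l"
    then have "\<psi> x \<theta> = 2 * M * psi0 x \<theta>" if "x \<in> S" for x
      using extremal_psi[OF \<theta> M E0 l(2) b _ that] by simp
    then show ?thesis using \<open>M > 0\<close> by (intro exI[of _ "2 * M"]) auto
  next
    assume eq: "2 * M * b = - l"
    have "- \<psi> x \<theta> = 2 * M * psi0 x \<theta>" if "x \<in> S" for x
      by (rule extremal_psi[OF \<theta> _ _ l' b _ that]) (use M E0 eq in auto)
    then have "\<psi> x \<theta> = - (2 * M) * psi0 x \<theta>" if "x \<in> S" for x
      using that by (metis minus_equation_iff mult_minus_left)
    then show ?thesis using \<open>M > 0\<close> by (intro exI[of _ "- (2 * M)"]) auto
  qed
qed

end

section \<open>Optimality\<close>

text \<open>A nonempty open set contains two distinct points. Serves to exclude a one-point support,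
  where the score is constant in the parameter.\<close>

lemma not_strict_mono_on_const:
  fixes f :: "real \<Rightarrow> real"
  assumes "open A" "A \<noteq> {}" "\<And>t. t \<in> A \<Longrightarrow> f t = v"
  shows "\<not> strict_mono_on A f" "\<not> strict_antimono_on A f"
proof -
  obtain a where a: "a \<in> A" using assms(2) by blast
  obtain c where "c > a" "{a..<c} \<subseteq> A" using open_right[OF assms(1) a, of "a + 1"] by auto
  then obtain b where b: "b > a" "b \<in> A" using dense[of a c] by (metis atLeastLessThan_iff less_imp_le subsetD)
  show "\<not> strict_mono_on A f" "\<not> strict_antimono_on A f"
    using a b assms(3) by (auto simp: monotone_on_def)
qed

theorem theorem1:
  fixes F :: "real \<Rightarrow> nat pmf" and \<Theta> :: "real set" and S :: "nat set"
  assumes "open \<Theta>" and "connected \<Theta>"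
    and support: "\<And>\<theta>. \<theta> \<in> \<Theta> \<Longrightarrow> set_pmf (F \<theta>) = S"
    and score_exists: "\<And>x \<theta>. x \<in> S \<Longrightarrow> \<theta> \<in> \<Theta> \<Longrightarrow> (\<lambda>t. ln (pmf (F t) x)) differentiable (at \<theta>)"
    and score_continuous: "continuous_on (S \<times> \<Theta>) (\<lambda>(x, \<theta>). score F x \<theta>)"
    and score_mono_x: "\<And>\<theta>. \<theta> \<in> \<Theta> \<Longrightarrow>
      strict_mono_on S (\<lambda>x. score F x \<theta>) \<or> strict_antimono_on S (\<lambda>x. score F x \<theta>)"
    and score_mono_theta: "\<And>x. x \<in> S \<Longrightarrow>
      strict_mono_on \<Theta> (\<lambda>\<theta>. score F x \<theta>) \<or> strict_antimono_on \<Theta> (\<lambda>\<theta>. score F x \<theta>)"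
  shows
    \<comment> \<open>the defining equation has at most one solution, for samples and in general\<close>
    "(\<forall>G. \<forall>t\<in>\<Theta>. umed G = umed (F t) \<longrightarrow> umed_est F \<Theta> G = t) \<and>
    \<comment> \<open>the estimator belongs to the class of competitors\<close>
     (\<exists>\<psi>. Fisher_consistent_M_estimator F \<Theta> S \<psi> (umed_dom F \<Theta>) (umed_est F \<Theta>) \<and>
       (\<forall>xs. \<forall>t\<in>\<Theta>. xs \<noteq> [] \<longrightarrow> umed (empirical xs) = umed (F t) \<longrightarrow> (\<Sum>x\<leftarrow>xs. \<psi> x t) = 0)) \<and>
    \<comment> \<open>it has the smallest GES at every parameter\<close>
     (\<forall>\<psi> D T. Fisher_consistent_M_estimator F \<Theta> S \<psi> D T \<longrightarrow>
       (\<forall>\<theta>\<in>\<Theta>. GES S (umed_est F \<Theta>) (F \<theta>) \<le> GES S T (F \<theta>))) \<and>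
    \<comment> \<open>it is the only one, where no unobserved value splits the mass of \<open>G\<close> into two halves\<close>
     (\<forall>\<psi> D T. Fisher_consistent_M_estimator F \<Theta> S \<psi> D T \<longrightarrow>
       (\<forall>\<theta>\<in>\<Theta>. GES S T (F \<theta>) \<le> GES S (umed_est F \<Theta>) (F \<theta>)) \<longrightarrow>
       (\<forall>G\<in>D. set_pmf G \<subseteq> S \<longrightarrow>
         (\<forall>k\<in>S. pmf G k = 0 \<longrightarrow> measure_pmf.prob G {..<k} \<noteq> 1/2) \<longrightarrow>
         G \<in> umed_dom F \<Theta> \<and> T G = umed_est F \<Theta> G))"
proof (cases "\<Theta> = {}")
  case True
  \<comment> \<open>Without parameters \<open>umed_dom\<close> is empty, and membership of
    \<open>T G\<close> in \<open>\<Theta>\<close> forces \<open>D\<close> to be empty too.\<close>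
  then show ?thesis
    by (auto simp: Fisher_consistent_M_estimator_def M_estimator_def Fisher_consistent_def
        regular_psi_def umed_dom_def)
next
  case False
  then obtain \<theta>0 where \<theta>0: "\<theta>0 \<in> \<Theta>" by blast
  \<comment> \<open>On a one-point support the mass is constantly 1 and the score 0, which is not
    strictly monotone in the parameter.\<close>
  have two: "\<exists>x\<in>S. x \<noteq> k" for k
  proof (rule ccontr)
    assume "\<not> (\<exists>x\<in>S. x \<noteq> k)"
    moreover have "S \<noteq> {}" using support[OF \<theta>0] set_pmf_not_empty by metis
    ultimately have S: "S = {k}" by auto
    have "pmf (F t) k = 1" if "t \<in> \<Theta>" for t
      using support[OF that] S set_pmf_subset_singleton[of "F t" k] by simp
    then have "score F k t = 0" if "t \<in> \<Theta>" for t
      unfolding score_def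
      by (intro DERIV_imp_deriv has_field_derivative_transform_within_open[OF DERIV_const \<open>open \<Theta>\<close> that]) simp
    then show False
      using score_mono_theta[of k] not_strict_mono_on_const[OF \<open>open \<Theta>\<close> False] S by blast
  qed
  obtain x0 y0 where xy0: "x0 \<in> S" "y0 \<in> S" "x0 < y0"
    using two by (metis linorder_neqE_nat)
  \<comment> \<open>A priori the direction of monotonicity in \<open>x\<close> may depend on the
    parameter. The score gap between two fixed points is continuous and nowhere 0 on the connected
    \<open>\<Theta>\<close>, so it has one sign, and this is \<open>\<sigma>\<close>.\<close>
  define g where "g t = score F y0 t - score F x0 t" for t
  have cont: "continuous_on \<Theta> (score F x)" if "x \<in> S" for x
  proof -
    have "continuous_on \<Theta> (\<lambda>t. case (x, t) of (x, \<theta>) \<Rightarrow> score F x \<theta>)"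
      by (rule continuous_on_compose2[OF score_continuous]) (use that in \<open>auto intro!: continuous_intros\<close>)
    then show ?thesis by simp
  qed
  have "connected (g ` \<Theta>)"
    unfolding g_def using xy0 \<open>connected \<Theta>\<close>
    by (intro connected_continuous_image continuous_on_diff cont)
  moreover have "0 \<notin> g ` \<Theta>"
    using score_mono_x xy0 by (fastforce simp: g_def monotone_on_def)
  ultimately have "(\<forall>t\<in>\<Theta>. g t > 0) \<or> (\<forall>t\<in>\<Theta>. g t < 0)"
    using connectedD_interval[of "g ` \<Theta>" _ _ 0] by (meson imageI not_less)
  then have "\<exists>\<sigma>::real. (\<sigma> = 1 \<or> \<sigma> = -1) \<and> (\<forall>t\<in>\<Theta>. \<sigma> * g t > 0)"
  proof
    assume "\<forall>t\<in>\<Theta>. g t > 0"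
    then show ?thesis by (intro exI[of _ 1]) simp
  next
    assume "\<forall>t\<in>\<Theta>. g t < 0"
    then show ?thesis by (intro exI[of _ "-1"]) simp
  qed
  then obtain \<sigma> :: real where \<sigma>: "\<sigma> = 1 \<or> \<sigma> = -1" "\<And>t. t \<in> \<Theta> \<Longrightarrow> \<sigma> * g t > 0"
    by blast
  have mono: "\<sigma> * score F x t < \<sigma> * score F y t" if "t \<in> \<Theta>" "x \<in> S" "y \<in> S" "x < y" for x y t
    using score_mono_x[OF that(1)]
  proof
    assume m: "strict_mono_on S (\<lambda>x. score F x t)"
    then have "g t > 0" "score F x t < score F y t"
      using xy0 that by (auto simp: g_def monotone_on_def)
    then show ?thesis using \<sigma>(1) \<sigma>(2)[OF that(1)] by auto
  next
    assume m: "strict_antimono_on S (\<lambda>x. score F x t)"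
    then have "g t < 0" "score F x t > score F y t"
      using xy0 that by (auto simp: g_def monotone_on_def)
    then show ?thesis using \<sigma>(1) \<sigma>(2)[OF that(1)] by auto
  qed
  have ln_deriv: "((\<lambda>t. ln (pmf (F t) x)) has_real_derivative score F x t) (at t)"
    if "x \<in> S" "t \<in> \<Theta>" for x t
    using score_exists[OF that] by (simp add: score_def DERIV_deriv_iff_real_differentiable)
  have pos: "pmf (F t) x > 0" if "x \<in> S" "t \<in> \<Theta>" for x t
    using support[OF that(2)] that(1) by (metis pmf_positive)
  interpret mlr_family F \<Theta> S \<sigma> "score F"
  proof
    fix x \<theta> assume x: "x \<in> S" and \<theta>: "\<theta> \<in> \<Theta>"
    have "((\<lambda>t. exp (ln (pmf (F t) x))) has_real_derivative exp (ln (pmf (F \<theta>) x)) * score F x \<theta>) (at \<theta>)"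
      by (rule DERIV_chain2[OF DERIV_exp ln_deriv[OF x \<theta>]])
    then have "((\<lambda>t. pmf (F t) x) has_real_derivative exp (ln (pmf (F \<theta>) x)) * score F x \<theta>) (at \<theta>)"
      by (rule has_field_derivative_transform_within_open[OF _ \<open>open \<Theta>\<close> \<theta>]) (simp add: pos x)
    then show "((\<lambda>t. pmf (F t) x) has_real_derivative pmf (F \<theta>) x * score F x \<theta>) (at \<theta>)"
      by (simp add: pos x \<theta>)
  next
    fix \<theta> \<theta>' x y
    assume \<theta>: "\<theta> \<in> \<Theta>" "\<theta>' \<in> \<Theta>" and lt: "\<sigma> * \<theta> < \<sigma> * \<theta>'" and xy: "x \<in> S" "y \<in> S" "x < y"
    \<comment> \<open>The log likelihood ratio has the score gap as its derivative, so it is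
      monotone between the two parameters in the direction given by \<open>\<sigma>\<close>.\<close>
    define h where "h t = ln (pmf (F t) y) - ln (pmf (F t) x)" for t
    have h: "(h has_real_derivative score F y t - score F x t) (at t)" if "t \<in> \<Theta>" for t
      unfolding h_def by (intro DERIV_diff ln_deriv xy that)
    note sub = connected_contains_Icc[OF \<open>connected \<Theta>\<close> \<theta>]
      connected_contains_Icc[OF \<open>connected \<Theta>\<close> \<theta>(2,1)]
    have "h \<theta> < h \<theta>'" using \<sigma>(1)
    proof
      assume s: "\<sigma> = 1"
      show ?thesis
        by (rule DERIV_pos_imp_increasing)
          (use s lt sub h mono[OF _ xy] in \<open>auto simp: subset_iff intro!: exI\<close>)
    next
      assume s: "\<sigma> = -1"
      show ?thesis
        by (rule DERIV_neg_imp_decreasing)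
          (use s lt sub h mono[OF _ xy] in \<open>auto simp: subset_iff intro!: exI\<close>)
    qed
    then have "ln (pmf (F \<theta>') x * pmf (F \<theta>) y) < ln (pmf (F \<theta>') y * pmf (F \<theta>) x)"
      using pos xy \<theta> by (simp add: h_def ln_mult_pos)
    then show "pmf (F \<theta>') x * pmf (F \<theta>) y < pmf (F \<theta>') y * pmf (F \<theta>) x"
      using pos xy \<theta> by simp
  qed (use \<open>open \<Theta>\<close> support two \<sigma>(1) mono in auto)

  \<comment> \<open>The claims of the theorem, from the results on the family\<close>
  show ?thesis
  proof (intro conjI allI ballI impI exI[of _ psi0])
    fix xs :: "nat list" and t
    assume "xs \<noteq> []" "umed (empirical xs) = umed (F t)"
    then show "(\<Sum>x\<leftarrow>xs. psi0 x t) = 0"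
      using M_equation_psi0 M_equation_empirical by blast
  next
    fix \<psi> D T \<theta> assume T: "Fisher_consistent_M_estimator F \<Theta> S \<psi> D T" and \<theta>: "\<theta> \<in> \<Theta>"
    obtain b where b: "((\<lambda>t. measure_pmf.expectation (F t) (\<lambda>y. psi0 y \<theta>)) has_real_derivative b) (at \<theta>)"
      using M_estimator_derivs[OF umed_est_competitor \<theta>] by blast
    show "GES S (umed_est F \<Theta>) (F \<theta>) \<le> GES S T (F \<theta>)"
      using GES_umed_est_le[OF \<theta> b] optimal_psi(1)[OF T \<theta> b] by (rule order_trans)
  next
    fix \<psi> D T G
    assume T: "Fisher_consistent_M_estimator F \<Theta> S \<psi> D T"
      and opt: "\<forall>\<theta>\<in>\<Theta>. GES S T (F \<theta>) \<le> GES S (umed_est F \<Theta>) (F \<theta>)"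
      and G: "G \<in> D" "set_pmf G \<subseteq> S"
      and split: "\<forall>k\<in>S. pmf G k = 0 \<longrightarrow> measure_pmf.prob G {..<k} \<noteq> 1/2"
    \<comment> \<open>Equality of the GES is exploited only at the parameter \<open>T G\<close>, so
      the factor \<open>c\<close> below may vary with the parameter.\<close>
    define \<theta> where "\<theta> = T G"
    have \<theta>: "\<theta> \<in> \<Theta>" and EG: "measure_pmf.expectation G (\<lambda>x. \<psi> x \<theta>) = 0"
      using T G(1) by (auto simp: Fisher_consistent_M_estimator_def M_estimator_def M_equation_def \<theta>_def)
    obtain b where b: "((\<lambda>t. measure_pmf.expectation (F t) (\<lambda>y. psi0 y \<theta>)) has_real_derivative b) (at \<theta>)"
      using M_estimator_derivs[OF umed_est_competitor \<theta>] by blast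
    have "GES S T (F \<theta>) \<le> ereal (1 / (2 * \<bar>b\<bar>))"
      using opt \<theta> GES_umed_est_le[OF \<theta> b] by (blast intro: order_trans)
    from optimal_psi(2)[OF T \<theta> b this]
    obtain c where c: "c \<noteq> 0" "\<And>x. x \<in> S \<Longrightarrow> \<psi> x \<theta> = c * psi0 x \<theta>" by blast
    \<comment> \<open>\<open>G\<close> lives on \<open>S\<close>, where \<open>\<psi>\<close> is a
      nonzero multiple of \<open>psi0\<close>, so \<open>G\<close> satisfies the Huber equation at
      \<open>\<theta>\<close>; the condition \<open>split\<close> then turns it into equality of the
      medians.\<close>
    have "measure_pmf.expectation G (\<lambda>x. \<psi> x \<theta>) = measure_pmf.expectation G (\<lambda>x. c * psi0 x \<theta>)"
      using G(2) c(2) by (intro integral_cong_AE) (auto simp: AE_measure_pmf_iff)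
    then have "measure_pmf.expectation G (huber (umed (F \<theta>))) = 0"
      using EG c(1) by (simp flip: psi0_conv)
    then have "umed G = umed (F \<theta>)"
      using split \<theta> by (intro umed_eq_of_expectation_huber) (auto simp: support)
    then show "G \<in> umed_dom F \<Theta>" "T G = umed_est F \<Theta> G"
      using \<theta> umed_est_eq by (auto simp: umed_dom_def \<theta>_def)
  qed (auto intro: umed_est_eq umed_est_competitor)
qed

end
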